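(* Let $\mathcal{E}_4=\{\ket{\psi_1},\ket{\psi_2},\ket{\psi_3},\ket{\psi_4}\}\subset\mathbb{C}^2\otimes\mathbb{C}^2$ be a set of four pairwise orthogonal normalized pure states ($\langle\psi_i|\psi_j\rangle=\delta_{ij}$), each sampled with probability $1/4$. Then $\mathcal{E}_4$ is two-copy distinguishable under adaptive LOCC if and only if one of the following holds: (i) the set is perfectly distinguishable by LOCC from a single copy (the second copy is not needed at all); (ii) there is an LOCC protocol on the first copy that leads with certainty to the conclusion that the given state belongs to the group $\mathcal{G}_l=\{\ket{\psi_l}\}$ or to its complement $\mathcal{G}_l^{\mathsf{C}}=\mathcal{E}_4\setminus\mathcal{G}_l$, for some $l\in\{1,2,3,4\}$, such that $\mathcal{G}_l^{\mathsf{C}}$ contains no more than one entangled state; (iii) there is an LOCC protocol on the first copy that leads with certainty to the conclusion that the given state belongs to the group $\mathcal{G}_{ij}=\{\ket{\psi_i},\ket{\psi_j}\}$ or to its complement, for some $i\neq j$ in $\{1,2,3,4\}$, such that the projectors $\mathbb{P}_{ij}:=\ket{\psi_i}\bra{\psi_i}+\ket{\psi_j}\bra{\psi_j}$ and $\mathbb{P}_{ij}^{\mathsf{C}}:=\mathbf{I}_4-\mathbb{P}_{ij}$ are both separable.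
   Context: Two spatially separated parties (Alice holding the first qubit, Bob the second) are given $k$ copies $\ket{\psi_i}^{\otimes k}$ of an unknown state drawn from a known ensemble and must identify $i$ with certainty. In an adaptive LOCC strategy each copy is addressed individually by local quantum operations and classical communication (LOCC) acting on that copy only, and the strategy used on later copies may depend on the outcomes obtained from earlier copies. "Two-copy distinguishable under adaptive LOCC" means perfect identification is possible with such a strategy using two copies. A positive operator on $\mathbb{C}^2\otimes\mathbb{C}^2$ is separable if it is a nonnegative combination of product operators $A\otimes B$ with $A,B\ge 0$; a state is entangled if it is not a product state. *)

theory Defs
  imports "HOL-Analysis.Analysis"
begin

type_synonym qvec = "complex ^ 2"
type_synonym qop = "complex ^ 2 ^ 2"
type_synonym tvec = "complex ^ (2 \<times> 2)"
type_synonym top = "complex ^ (2 \<times> 2) ^ (2 \<times> 2)"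

definition cinner :: "complex ^ 'n \<Rightarrow> complex ^ 'n \<Rightarrow> complex" where
  "cinner u v = (\<Sum>k\<in>UNIV. cnj (u $ k) * v $ k)"

definition cadj :: "complex ^ 'n ^ 'n \<Rightarrow> complex ^ 'n ^ 'n" where
  "cadj A = (\<chi> i j. cnj (A $ j $ i))"

definition proj :: "complex ^ 'n \<Rightarrow> complex ^ 'n ^ 'n" where
  "proj u = (\<chi> i j. u $ i * cnj (u $ j))"

definition psd :: "complex ^ 'n ^ 'n \<Rightarrow> bool" where
  "psd A \<longleftrightarrow> (\<forall>v. Im (cinner v (A *v v)) = 0 \<and> Re (cinner v (A *v v)) \<ge> 0)"

definition kron :: "qop \<Rightarrow> qop \<Rightarrow> top" where
  "kron A B = (\<chi> p q. A $ fst p $ fst q * B $ snd p $ snd q)"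

definition tensor :: "qvec \<Rightarrow> qvec \<Rightarrow> tvec" where
  "tensor a b = (\<chi> p. a $ fst p * b $ snd p)"

definition entangled :: "tvec \<Rightarrow> bool" where
  "entangled \<psi> \<longleftrightarrow> \<not> (\<exists>a b. \<psi> = tensor a b)"

definition separable :: "top \<Rightarrow> bool" where
  "separable P \<longleftrightarrow> (\<exists>cs :: (real \<times> qop \<times> qop) list.
      (\<forall>(c, A, B) \<in> set cs. c \<ge> 0 \<and> psd A \<and> psd B) \<and>
      P = sum_list (map (\<lambda>(c, A, B). c *\<^sub>R kron A B) cs))"

definition local_instr :: "qop list \<Rightarrow> bool" where
  "local_instr As \<longleftrightarrow> As \<noteq> [] \<and> sum_list (map (\<lambda>A. cadj A ** A) As) = mat 1"

text \<open>Kraus operators (one per final classical outcome) of a (finite-round, finite-outcome)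
  LOCC protocol: starting from the trivial protocol, in each round, for every current
  branch, one party applies a local instrument chosen depending on all previous outcomes.\<close>
inductive locc_kraus :: "top list \<Rightarrow> bool" where
  triv: "locc_kraus [mat 1]"
| alice: "locc_kraus Ks \<Longrightarrow> (\<forall>m<length Ks. local_instr (F m)) \<Longrightarrow>
    locc_kraus (concat (map (\<lambda>m. map (\<lambda>A. kron A (mat 1) ** (Ks ! m)) (F m)) [0..<length Ks]))"
| bob: "locc_kraus Ks \<Longrightarrow> (\<forall>m<length Ks. local_instr (F m)) \<Longrightarrow>
    locc_kraus (concat (map (\<lambda>m. map (\<lambda>B. kron (mat 1) B ** (Ks ! m)) (F m)) [0..<length Ks]))"

text \<open>Outcome with Kraus operator K occurs with nonzero probability on state \<psi> iff K \<psi> \<noteq> 0.\<close>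

definition idx :: "nat set" where "idx = {1..4}"

definition locc_one_copy :: "(nat \<Rightarrow> tvec) \<Rightarrow> bool" where
  "locc_one_copy \<psi> \<longleftrightarrow> (\<exists>Ks. locc_kraus Ks \<and>
     (\<forall>K\<in>set Ks. \<forall>i\<in>idx. \<forall>j\<in>idx. K *v \<psi> i \<noteq> 0 \<longrightarrow> K *v \<psi> j \<noteq> 0 \<longrightarrow> i = j))"

definition locc_group :: "(nat \<Rightarrow> tvec) \<Rightarrow> nat set \<Rightarrow> bool" where
  "locc_group \<psi> G \<longleftrightarrow> (\<exists>Ks. locc_kraus Ks \<and>
     (\<forall>K\<in>set Ks. (\<forall>i\<in>idx. K *v \<psi> i \<noteq> 0 \<longrightarrow> i \<in> G) \<or> (\<forall>i\<in>idx. K *v \<psi> i \<noteq> 0 \<longrightarrow> i \<notin> G)))"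

definition locc_two_copy_adaptive :: "(nat \<Rightarrow> tvec) \<Rightarrow> bool" where
  "locc_two_copy_adaptive \<psi> \<longleftrightarrow> (\<exists>Ks L. locc_kraus Ks \<and> (\<forall>m<length Ks. locc_kraus (L m)) \<and>
     (\<forall>m<length Ks. \<forall>K'\<in>set (L m). \<forall>i\<in>idx. \<forall>j\<in>idx.
        (Ks ! m) *v \<psi> i \<noteq> 0 \<longrightarrow> K' *v \<psi> i \<noteq> 0 \<longrightarrow>
        (Ks ! m) *v \<psi> j \<noteq> 0 \<longrightarrow> K' *v \<psi> j \<noteq> 0 \<longrightarrow> i = j))"

end

theory Submission
  imports Defs
begin

text \<open>Two of the three alternatives already suffice: an adaptive protocol forces (i) or (iii).
  In the protocol for the first copy consider a last branch whose Kraus operator is invertible and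
  let, say, Alice act there. She then projects onto at least two independent directions. If some
  leaf excludes fewer than two states, either all four or some three states are distinguishable
  from a single copy, and three distinguishable states include two product states, by the same
  analysis of a last invertible branch. Otherwise every leaf excludes two states. For a direction
  \<open>a\<close> of Alice, two independent directions \<open>b\<close>, \<open>b'\<close> of Bob exclude either complementary pairs,
  and then \<open>a \<otimes> b'\<close> lies in the span of one pair, whose second dimension is filled by a product
  vector as well; or they exclude a common state, which must then be \<open>a\<^sup>\<bottom> \<otimes> c\<close>, so that
  two independent directions of Alice yield two product states. Two orthogonal product states
  always span one block of a splitting as in (iii). Conversely, after the splitting two orthogonal
  states are left, and these are distinguishable in any basis of Alice in which a certain
  traceless matrix has zero diagonal.\<close>

section \<open>Coordinates, inner products and tensor products\<close>

lemma sum_22: "sum f (UNIV :: (2 \<times> 2) set) = f (1,1) + f (1,2) + f (2,1) + f (2,2)"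
  for f :: "2 \<times> 2 \<Rightarrow> 'a :: comm_monoid_add"
proof -
  have "sum f (UNIV :: (2 \<times> 2) set) = (\<Sum>x\<in>UNIV. \<Sum>y\<in>UNIV. f (x, y))"
    by (simp add: sum.cartesian_product)
  then show ?thesis by (simp add: sum_2 add.assoc)
qed

lemma forall_22: "(\<forall>p :: 2 \<times> 2. P p) \<longleftrightarrow> P (1,1) \<and> P (1,2) \<and> P (2,1) \<and> P (2,2)"
  by (auto simp: split_paired_All forall_2)

lemma vec2_eq_iff: "u = v \<longleftrightarrow> u $ 1 = v $ 1 \<and> u $ 2 = v $ 2" for u v :: "'a ^ 2"
  by (simp add: vec_eq_iff forall_2)

lemma vec22_eq_iff:
  "u = v \<longleftrightarrow> u $ (1,1) = v $ (1,1) \<and> u $ (1,2) = v $ (1,2) \<and> u $ (2,1) = v $ (2,1) \<and> u $ (2,2) = v $ (2,2)"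
  for u v :: "'a ^ (2 \<times> 2)"
  by (simp only: vec_eq_iff forall_22)

lemma tensor_nth [simp]: "tensor a b $ (i, j) = a $ i * b $ j"
  by (simp add: tensor_def)

lemma kron_nth [simp]: "kron A B $ (i, j) $ (k, l) = A $ i $ k * B $ j $ l"
  by (simp add: kron_def)

lemma kron_mult: "kron A B ** kron C D = kron (A ** C) (B ** D)"
  by (simp add: vec22_eq_iff matrix_matrix_mult_def sum_22 sum_2 algebra_simps)

lemma kron_mat_1: "kron (mat 1) (mat 1) = mat 1"
  by (simp add: vec22_eq_iff mat_def)

lemma proj_tensor: "proj (tensor a b) = kron (proj a) (proj b)"
  by (simp add: vec22_eq_iff proj_def)

lemma cinner_tensor: "cinner (tensor a b) (tensor c d) = cinner a c * cinner b d"
  by (simp add: cinner_def sum_22 sum_2 algebra_simps)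

lemma cinner_commute: "cinner u v = cnj (cinner v u)"
  by (simp add: cinner_def mult.commute)

lemma cinner_adj: "cinner u (cadj A *v v) = cinner (A *v u) v"
proof -
  have "cinner u (cadj A *v v) = (\<Sum>k\<in>UNIV. \<Sum>j\<in>UNIV. cnj (u $ k) * (cnj (A $ j $ k) * v $ j))"
    by (simp add: cinner_def cadj_def matrix_vector_mult_def sum_distrib_left)
  also have "\<dots> = (\<Sum>j\<in>UNIV. \<Sum>k\<in>UNIV. cnj (u $ k) * (cnj (A $ j $ k) * v $ j))"
    by (rule sum.swap)
  also have "\<dots> = cinner (A *v u) v"
    by (simp add: cinner_def matrix_vector_mult_def sum_distrib_right sum_distrib_left algebra_simps)
  finally show ?thesis .
qed

lemma proj_mult_vec: "proj u *v v = cinner u v *s u"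
  by (simp add: vec_eq_iff proj_def matrix_vector_mult_def cinner_def sum_distrib_left sum_distrib_right algebra_simps)

lemma cinner_linear:
  "cinner u (v + w) = cinner u v + cinner u w"
  "cinner u (v - w) = cinner u v - cinner u w"
  "cinner u (c *s v) = c * cinner u v"
  "cinner (v + w) u = cinner v u + cinner w u"
  "cinner (v - w) u = cinner v u - cinner w u"
  "cinner (c *s v) u = cnj c * cinner v u"
  "cinner u 0 = 0" "cinner 0 u = 0"
  by (simp_all add: cinner_def sum.distrib sum_subtractf sum_distrib_left algebra_simps)

section \<open>Measurements in orthonormal bases\<close>

definition onpair :: "qvec \<Rightarrow> qvec \<Rightarrow> bool" where
  "onpair a a' \<longleftrightarrow> cinner a a = 1 \<and> cinner a' a' = 1 \<and> cinner a a' = 0"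

lemma onpair_commute: "onpair a a' \<Longrightarrow> onpair a' a"
  using cinner_commute[of a' a] by (auto simp: onpair_def)

text \<open>The matrix \<open>U\<close> with columns \<open>a\<close> and \<open>a'\<close> is an
  isometry; being square, it also satisfies \<open>U ** cadj U = mat 1\<close>, which is the
  resolution of the identity.\<close>

lemma onpair_proj_sum:
  assumes "onpair a a'"
  shows "proj a + proj a' = mat 1"
proof -
  define U :: qop where "U = (\<chi> i j. if j = 1 then a $ i else a' $ i)"
  have "cinner a' a = 0" using assms cinner_commute[of a' a] by (simp add: onpair_def)
  then have "cadj U ** U = mat 1"
    using assms
    by (simp add: onpair_def vec2_eq_iff U_def cadj_def matrix_matrix_mult_def mat_def cinner_def sum_2)
  then have "U ** cadj U = mat 1" using matrix_left_right_inverse by blast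
  then show ?thesis
    by (simp add: vec2_eq_iff U_def cadj_def matrix_matrix_mult_def mat_def proj_def sum_2)
qed

lemma proj_idem: "cinner a a = 1 \<Longrightarrow> cadj (proj a) ** proj a = proj a"
proof -
  assume a: "cinner a a = 1"
  have "(cadj (proj a) ** proj a) $ i $ j = cinner a a * (proj a $ i $ j)" for i j
    by (simp add: cadj_def proj_def matrix_matrix_mult_def cinner_def sum_distrib_right sum_distrib_left algebra_simps)
  then show ?thesis by (simp add: a vec_eq_iff)
qed

lemma local_instr_onpair: "onpair a a' \<Longrightarrow> local_instr [proj a, proj a']"
  using onpair_proj_sum by (simp add: local_instr_def proj_idem onpair_def)

text \<open>The conjugation makes \<open>perp a\<close> orthogonal to \<open>a\<close> for the
  sesquilinear \<open>cinner\<close>, with the same norm. It makes sense for unnormalised directions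
  too.\<close>

definition perp :: "qvec \<Rightarrow> qvec" where
  "perp a = (\<chi> i. if i = 1 then - cnj (a $ 2) else cnj (a $ 1))"

lemma onpair_perp: "cinner a a = 1 \<Longrightarrow> onpair a (perp a)"
  by (simp add: onpair_def perp_def cinner_def sum_2 algebra_simps)

lemma cinner_eq_norm: "cinner u u = complex_of_real ((norm u)^2)"
  unfolding cinner_def norm_vec_def L2_set_def
  by (simp add: sum_nonneg mult.commute[of "cnj _"] complex_norm_square del: of_real_power)

lemma obtain_unit:
  assumes "u \<noteq> 0"
  obtains r v where "r > 0" "v = complex_of_real r *s u" "cinner v v = 1"
proof -
  have n: "norm u > 0" using assms by simp
  show thesis
  proof
    show "1 / norm u > 0" using n by simp
    show "complex_of_real (1 / norm u) *s u = complex_of_real (1 / norm u) *s u" ..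
    have "norm u \<noteq> 0" using n by simp
    then show "cinner (complex_of_real (1 / norm u) *s u) (complex_of_real (1 / norm u) *s u) = 1"
      by (simp add: cinner_linear cinner_eq_norm[of u] power2_eq_square)
  qed
qed

text \<open>The one-way protocol behind every construction here: Alice measures first, and Bob
  chooses the basis \<open>b\<close>, \<open>b'\<close> or \<open>d\<close>, \<open>d'\<close>
  according to her outcome.\<close>

lemma locc_kraus_onpairs:
  assumes "onpair a a'" "onpair b b'" "onpair d d'"
  obtains Ks where "locc_kraus Ks"
    "set Ks = {kron (proj a) (proj b), kron (proj a) (proj b'), kron (proj a') (proj d), kron (proj a') (proj d')}"
proof -
  define F where "F = (\<lambda>m::nat. [proj a, proj a'])"
  define G where "G = (\<lambda>m::nat. if m = 0 then [proj b, proj b'] else [proj d, proj d'])"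
  have 1: "locc_kraus [kron (proj a) (mat 1), kron (proj a') (mat 1)]"
    using locc_kraus.alice[OF locc_kraus.triv, of F] local_instr_onpair[OF assms(1)] by (simp add: F_def)
  have "locc_kraus [kron (proj a) (proj b), kron (proj a) (proj b'), kron (proj a') (proj d), kron (proj a') (proj d')]"
    using locc_kraus.bob[OF 1, of G] assms[THEN local_instr_onpair]
    by (simp add: G_def less_Suc_eq upt_rec kron_mult)
  then show thesis by (rule that) auto
qed

lemma kron_proj_kills: "cinner (tensor a b) \<phi> = 0 \<Longrightarrow> kron (proj a) (proj b) *v \<phi> = 0"
  by (simp add: proj_tensor[symmetric] proj_mult_vec)

lemma psd_proj: "psd (proj u)"
proof -
  have "cinner v (proj u *v v) = complex_of_real ((cmod (cinner u v))^2)" for v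
    using cinner_commute[of v u]
    by (simp add: proj_mult_vec cinner_linear complex_norm_square del: of_real_power)
  then show ?thesis by (simp add: psd_def)
qed

lemma separable_proj_sum: "separable (proj (tensor a b) + proj (tensor c d))"
  unfolding separable_def
  by (rule exI[of _ "[(1, proj a, proj b), (1, proj c, proj d)]"]) (simp add: psd_proj proj_tensor)

section \<open>Exchanging the two parties\<close>

text \<open>Vectors, operators and whole protocols are transported to exchanged roles, so that Bob's
  half of each argument follows from Alice's.\<close>

definition swv :: "tvec \<Rightarrow> tvec" where
  "swv \<phi> = (\<chi> p. \<phi> $ (snd p, fst p))"

definition swo :: "top \<Rightarrow> top" where
  "swo K = (\<chi> p q. K $ (snd p, fst p) $ (snd q, fst q))"

lemma swv_nth [simp]: "swv \<phi> $ (i, j) = \<phi> $ (j, i)"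
  by (simp add: swv_def)

lemma swo_nth [simp]: "swo K $ (i, j) $ (k, l) = K $ (j, i) $ (l, k)"
  by (simp add: swo_def)

lemma swv_swv [simp]: "swv (swv \<phi>) = \<phi>" by (simp add: vec22_eq_iff)
lemma swo_swo [simp]: "swo (swo K) = K" by (simp add: vec22_eq_iff)
lemma swo_kron [simp]: "swo (kron A B) = kron B A" by (simp add: vec22_eq_iff)
lemma swv_tensor [simp]: "swv (tensor a b) = tensor b a" by (simp add: vec22_eq_iff)
lemma swv_eq_0 [simp]: "swv \<phi> = 0 \<longleftrightarrow> \<phi> = 0" by (auto simp: vec22_eq_iff)
lemma swo_mat_1 [simp]: "swo (mat 1) = mat 1" by (simp add: vec22_eq_iff mat_def)
lemma swo_add [simp]: "swo (K + L) = swo K + swo L" by (simp add: vec22_eq_iff)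
lemma swo_diff [simp]: "swo (K - L) = swo K - swo L" by (simp add: vec22_eq_iff)
lemma swo_scaleR [simp]: "swo (c *\<^sub>R K) = c *\<^sub>R swo K" by (simp add: vec22_eq_iff)
lemma swo_zero [simp]: "swo 0 = 0" by (simp add: vec22_eq_iff)
lemma swo_proj [simp]: "swo (proj u) = proj (swv u)" by (simp add: vec22_eq_iff proj_def)
lemma swo_mult [simp]: "swo (K ** L) = swo K ** swo L"
  by (simp add: vec22_eq_iff matrix_matrix_mult_def sum_22 algebra_simps)
lemma swo_mult_vec: "swo K *v \<phi> = swv (K *v swv \<phi>)"
  by (simp add: vec22_eq_iff matrix_vector_mult_def sum_22 algebra_simps)
lemma mult_swv: "K *v swv \<phi> = swv (swo K *v \<phi>)"
  by (simp add: swo_mult_vec)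
lemma cinner_swv [simp]: "cinner (swv u) (swv v) = cinner u v"
  by (simp add: cinner_def sum_22 algebra_simps)

lemma locc_kraus_swap: "locc_kraus Ks \<Longrightarrow> locc_kraus (map swo Ks)"
proof (induction rule: locc_kraus.induct)
  case triv
  then show ?case by (simp add: locc_kraus.triv)
next
  case (alice Ks F)
  have "locc_kraus (concat (map (\<lambda>m. map (\<lambda>B. kron (mat 1) B ** (map swo Ks ! m)) (F m)) [0..<length (map swo Ks)]))"
    using alice by (intro locc_kraus.bob) auto
  also have "concat (map (\<lambda>m. map (\<lambda>B. kron (mat 1) B ** (map swo Ks ! m)) (F m)) [0..<length (map swo Ks)]) =
    map swo (concat (map (\<lambda>m. map (\<lambda>A. kron A (mat 1) ** (Ks ! m)) (F m)) [0..<length Ks]))"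
    by (simp add: map_concat o_def cong: map_cong) (intro arg_cong[of _ _ concat] map_cong; simp)
  finally show ?case .
next
  case (bob Ks F)
  have "locc_kraus (concat (map (\<lambda>m. map (\<lambda>B. kron B (mat 1) ** (map swo Ks ! m)) (F m)) [0..<length (map swo Ks)]))"
    using bob by (intro locc_kraus.alice) auto
  also have "concat (map (\<lambda>m. map (\<lambda>B. kron B (mat 1) ** (map swo Ks ! m)) (F m)) [0..<length (map swo Ks)]) =
    map swo (concat (map (\<lambda>m. map (\<lambda>A. kron (mat 1) A ** (Ks ! m)) (F m)) [0..<length Ks]))"
    by (simp add: map_concat o_def cong: map_cong) (intro arg_cong[of _ _ concat] map_cong; simp)
  finally show ?case .
qed

lemma separable_swap:
  assumes "separable P"
  shows "separable (swo P)"
proof -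
  obtain cs where cs: "\<forall>(c, A, B) \<in> set cs. c \<ge> 0 \<and> psd A \<and> psd B"
    "P = sum_list (map (\<lambda>(c, A, B). c *\<^sub>R kron A B) cs)"
    using assms unfolding separable_def by blast
  have "swo (sum_list (map (\<lambda>(c, A, B). c *\<^sub>R kron A B) cs)) =
    sum_list (map (\<lambda>(c, A, B). c *\<^sub>R kron A B) (map (\<lambda>(c, A, B). (c, B, A)) cs))"
    by (induction cs) auto
  then show ?thesis
    unfolding separable_def using cs by (intro exI[of _ "map (\<lambda>(c, A, B). (c, B, A)) cs"]) auto
qed

lemma locc_group_swap:
  assumes "locc_group (\<lambda>i. swv (\<psi> i)) G"
  shows "locc_group \<psi> G"
proof -
  obtain Ks where Ks: "locc_kraus Ks" "\<forall>K\<in>set Ks.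
      (\<forall>i\<in>idx. K *v swv (\<psi> i) \<noteq> 0 \<longrightarrow> i \<in> G) \<or> (\<forall>i\<in>idx. K *v swv (\<psi> i) \<noteq> 0 \<longrightarrow> i \<notin> G)"
    using assms unfolding locc_group_def by blast
  show ?thesis unfolding locc_group_def
    using locc_kraus_swap[OF Ks(1)] Ks(2) by (intro exI[of _ "map swo Ks"]) (auto simp: swo_mult_vec)
qed

text \<open>Alternative (iii) of the theorem, named so that it can be transported under the exchange
  of parties.\<close>

definition separable_pair_split :: "(nat \<Rightarrow> tvec) \<Rightarrow> bool" where
  "separable_pair_split \<psi> \<longleftrightarrow> (\<exists>i\<in>idx. \<exists>j\<in>idx. i \<noteq> j \<and> locc_group \<psi> {i, j}
        \<and> separable (proj (\<psi> i) + proj (\<psi> j))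
        \<and> separable (mat 1 - (proj (\<psi> i) + proj (\<psi> j))))"

lemma separable_pair_split_swap:
  assumes "separable_pair_split (\<lambda>i. swv (\<psi> i))"
  shows "separable_pair_split \<psi>"
proof -
  obtain i j where ij: "i \<in> idx" "j \<in> idx" "i \<noteq> j" "locc_group (\<lambda>i. swv (\<psi> i)) {i, j}"
    "separable (proj (swv (\<psi> i)) + proj (swv (\<psi> j)))"
    "separable (mat 1 - (proj (swv (\<psi> i)) + proj (swv (\<psi> j))))"
    using assms unfolding separable_pair_split_def by blast
  show ?thesis unfolding separable_pair_split_def
    using ij locc_group_swap separable_swap[OF ij(5)] separable_swap[OF ij(6)] by auto
qed

section \<open>Separable splittings of an orthonormal basis\<close>

lemma idx_eq: "idx = {1, 2, 3, 4}"
  by (auto simp: idx_def)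

definition onb :: "(nat \<Rightarrow> tvec) \<Rightarrow> bool" where
  "onb \<psi> \<longleftrightarrow> (\<forall>i\<in>idx. \<forall>j\<in>idx. cinner (\<psi> i) (\<psi> j) = (if i = j then 1 else 0))"

lemma onb_swap: "onb \<psi> \<Longrightarrow> onb (\<lambda>i. swv (\<psi> i))"
  by (simp add: onb_def)

lemma onbD: "onb \<psi> \<Longrightarrow> i \<in> idx \<Longrightarrow> j \<in> idx \<Longrightarrow> cinner (\<psi> i) (\<psi> j) = (if i = j then 1 else 0)"
  by (simp add: onb_def)

lemma onb_nonzero: "onb \<psi> \<Longrightarrow> i \<in> idx \<Longrightarrow> \<psi> i \<noteq> 0"
  using onbD[of \<psi> i i] by (auto simp: cinner_linear)

text \<open>\<open>g\<close> numbers the four product indices by the labels of the states, so the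
  states become the columns of a square matrix \<open>U\<close>. Orthonormality is
  \<open>cadj U ** U = mat 1\<close>, and completeness is the reversed product.\<close>

lemma onb_complete:
  assumes "onb \<psi>"
  shows "(\<Sum>i\<in>idx. proj (\<psi> i)) = mat 1"
proof -
  define g :: "2 \<times> 2 \<Rightarrow> nat" where
    "g = (\<lambda>p. if fst p = 1 then (if snd p = 1 then 1 else 2) else (if snd p = 1 then 3 else 4))"
  define U :: top where "U = (\<chi> p q. \<psi> (g q) $ p)"
  have "(cadj U ** U) $ p $ q = cinner (\<psi> (g p)) (\<psi> (g q))" for p q
    by (simp add: U_def cadj_def matrix_matrix_mult_def cinner_def)
  moreover have "g p \<in> idx" for p by (simp add: g_def idx_eq)
  ultimately have "(cadj U ** U) $ p $ q = (if g p = g q then 1 else 0)" for p q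
    using assms by (simp add: onb_def)
  then have "cadj U ** U = mat 1"
    by (simp add: vec22_eq_iff mat_def g_def)
  then have "U ** cadj U = mat 1" using matrix_left_right_inverse by blast
  moreover have "U ** cadj U = (\<Sum>i\<in>idx. proj (\<psi> i))"
    by (simp add: vec_eq_iff U_def cadj_def matrix_matrix_mult_def proj_def sum_22 g_def idx_eq)
  ultimately show ?thesis by simp
qed

lemma sum_mult_vec: "(\<Sum>i\<in>S. A i) *v v = (\<Sum>i\<in>S. A i *v v)"
  for A :: "'b \<Rightarrow> complex ^ 'n ^ 'm"
  by (induction S rule: infinite_finite_induct) (simp_all add: matrix_vector_mult_add_rdistrib)

lemma onb_expand:
  assumes "onb \<psi>"
  shows "v = (\<Sum>i\<in>idx. cinner (\<psi> i) v *s \<psi> i)"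
proof -
  have "v = (\<Sum>i\<in>idx. proj (\<psi> i)) *v v" by (simp add: onb_complete[OF assms])
  then show ?thesis by (simp add: sum_mult_vec proj_mult_vec)
qed

lemma idx_complement:
  assumes "i \<in> idx" "j \<in> idx" "i \<noteq> j"
  obtains k l where "k \<in> idx" "l \<in> idx" "k \<noteq> l" "idx - {i, j} = {k, l}"
proof -
  have "card (idx - {i, j}) = 2" using assms by (subst card_Diff_subset) (auto simp: idx_def)
  then obtain k l where "idx - {i, j} = {k, l}" "k \<noteq> l" by (auto simp: card_2_iff)
  then show thesis using that[of k l] by blast
qed

lemma kron_add_left: "kron (A + A') B = kron A B + kron A' B"
  by (simp add: vec22_eq_iff algebra_simps)

lemma kron_add_right: "kron A (B + B') = kron A B + kron A B'"
  by (simp add: vec22_eq_iff algebra_simps)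

text \<open>The block of \<open>\<psi> i\<close>, \<open>\<psi> j\<close> has the basis
  \<open>tensor a b\<close>, \<open>tensor a' d\<close>, and its complement has
  \<open>tensor a b'\<close>, \<open>tensor a' d'\<close>. Alice measures \<open>a\<close>,
  \<open>a'\<close>, then Bob uses \<open>b\<close>, \<open>b'\<close> or \<open>d\<close>,
  \<open>d'\<close>: every outcome names a block, and both projectors are sums of product
  projectors.\<close>

lemma separable_pair_splitI:
  assumes onb: "onb \<psi>" and ij: "i \<in> idx" "j \<in> idx" "i \<noteq> j"
    and a: "onpair a a'" and b: "onpair b b'" and d: "onpair d d'"
    and P: "proj (\<psi> i) + proj (\<psi> j) = proj (tensor a b) + proj (tensor a' d)"
  shows "separable_pair_split \<psi>"
proof -
  have eq: "cinner (\<psi> i) \<phi> *s \<psi> i + cinner (\<psi> j) \<phi> *s \<psi> j =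
      cinner (tensor a b) \<phi> *s tensor a b + cinner (tensor a' d) \<phi> *s tensor a' d" for \<phi>
    using arg_cong[OF P, of "\<lambda>M. M *v \<phi>"] by (simp add: matrix_vector_mult_add_rdistrib proj_mult_vec)
  note on = a b d a[THEN onpair_commute] b[THEN onpair_commute] d[THEN onpair_commute]
  have 1: "cinner (tensor a b) (\<psi> k) = 0 \<and> cinner (tensor a' d) (\<psi> k) = 0"
    if k: "k \<in> idx" "k \<notin> {i, j}" for k
  proof -
    have z: "cinner (tensor a b) (\<psi> k) *s tensor a b + cinner (tensor a' d) (\<psi> k) *s tensor a' d = 0"
      using eq[of "\<psi> k"] k ij onbD[OF onb] by simp
    show ?thesis
      using arg_cong[OF z, of "cinner (tensor a b)"] arg_cong[OF z, of "cinner (tensor a' d)"] on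
      by (simp add: cinner_linear cinner_tensor onpair_def)
  qed
  have 2: "cinner (tensor a b') (\<psi> k) = 0 \<and> cinner (tensor a' d') (\<psi> k) = 0"
    if k: "k \<in> {i, j}" for k
  proof -
    have z: "\<psi> k = cinner (tensor a b) (\<psi> k) *s tensor a b + cinner (tensor a' d) (\<psi> k) *s tensor a' d"
      using eq[of "\<psi> k"] k ij onbD[OF onb] by auto
    show ?thesis
      using arg_cong[OF z, of "cinner (tensor a b')"] arg_cong[OF z, of "cinner (tensor a' d')"] on
      by (simp add: cinner_linear cinner_tensor onpair_def)
  qed
  obtain Ks where Ks: "locc_kraus Ks"
    "set Ks = {kron (proj a) (proj b), kron (proj a) (proj b'), kron (proj a') (proj d), kron (proj a') (proj d')}"
    using locc_kraus_onpairs[OF a b d] by blast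
  have "locc_group \<psi> {i, j}"
    unfolding locc_group_def
  proof (intro exI conjI)
    show "locc_kraus Ks" by (rule Ks)
    show "\<forall>K\<in>set Ks. (\<forall>k\<in>idx. K *v \<psi> k \<noteq> 0 \<longrightarrow> k \<in> {i, j}) \<or> (\<forall>k\<in>idx. K *v \<psi> k \<noteq> 0 \<longrightarrow> k \<notin> {i, j})"
      unfolding Ks(2) using 1 2 by (metis insertE singletonD kron_proj_kills)
  qed
  moreover have "mat 1 = proj (tensor a b) + proj (tensor a b') + (proj (tensor a' d) + proj (tensor a' d'))"
    unfolding proj_tensor kron_add_left[symmetric] kron_add_right[symmetric]
      onpair_proj_sum[OF b] onpair_proj_sum[OF d] onpair_proj_sum[OF a] kron_mat_1 ..
  then have "mat 1 - (proj (\<psi> i) + proj (\<psi> j)) = proj (tensor a b') + proj (tensor a' d')"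
    by (simp add: P)
  ultimately show ?thesis
    unfolding separable_pair_split_def using ij P separable_proj_sum by metis
qed

text \<open>The scalar normalising the first factor is compensated by its inverse on the second,
  which then is a unit vector because norms multiply.\<close>

lemma unit_tensor:
  assumes "cinner (tensor \<alpha> \<beta>) (tensor \<alpha> \<beta>) = 1"
  obtains a b where "tensor \<alpha> \<beta> = tensor a b" "cinner a a = 1" "cinner b b = 1"
proof -
  have "\<alpha> \<noteq> 0" using assms by (auto simp: cinner_tensor cinner_linear)
  then obtain r a where a: "r > 0" "a = complex_of_real r *s \<alpha>" "cinner a a = 1"
    by (rule obtain_unit)
  define b where "b = complex_of_real (1 / r) *s \<beta>"
  have t: "tensor \<alpha> \<beta> = tensor a b"
    using a(1) by (simp add: vec22_eq_iff a(2) b_def)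
  then show thesis
    using assms a(3) that[OF t] by (simp add: cinner_tensor)
qed

text \<open>The inner product of product states factorises, so the factors of one party are
  orthogonal. This party measures first; the case of Bob is reduced to that of Alice by
  exchange.\<close>

lemma two_products_split:
  assumes onb: "onb \<psi>" and ij: "i \<in> idx" "j \<in> idx" "i \<noteq> j"
    and "\<psi> i = tensor \<alpha> \<beta>" "\<psi> j = tensor \<gamma> \<delta>"
  shows "separable_pair_split \<psi>"
proof -
  obtain a b where ab: "\<psi> i = tensor a b" "cinner a a = 1" "cinner b b = 1"
    using unit_tensor[of \<alpha> \<beta>] onbD[OF onb, of i i] assms by auto
  obtain c d where cd: "\<psi> j = tensor c d" "cinner c c = 1" "cinner d d = 1"
    using unit_tensor[of \<gamma> \<delta>] onbD[OF onb, of j j] assms by auto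
  have "cinner a c * cinner b d = 0"
    using onbD[OF onb ij(1,2)] ij(3) by (simp add: ab cd cinner_tensor)
  then consider "cinner a c = 0" | "cinner b d = 0" by auto
  then show ?thesis
  proof cases
    case 1
    show ?thesis
      using separable_pair_splitI[OF onb ij, of a c b "perp b" d "perp d"] 1 ab cd onpair_perp
      by (simp add: onpair_def)
  next
    case 2
    have "separable_pair_split (\<lambda>i. swv (\<psi> i))"
      using separable_pair_splitI[OF onb_swap[OF onb] ij, of b d a "perp a" c "perp c"] 2 ab cd onpair_perp
      by (simp add: onpair_def)
    then show ?thesis by (rule separable_pair_split_swap)
  qed
qed

text \<open>Bob's unnormalised state after Alice has found \<open>a\<close>.\<close>

definition pc :: "qvec \<Rightarrow> tvec \<Rightarrow> qvec" where
  "pc a \<phi> = (\<chi> q. cnj (a $ 1) * \<phi> $ (1, q) + cnj (a $ 2) * \<phi> $ (2, q))"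

lemma cinner_tensor_pc: "cinner (tensor a b) \<phi> = cinner b (pc a \<phi>)"
  by (simp add: cinner_def pc_def sum_22 sum_2 algebra_simps)

lemma pc_scale: "pc (c *s a) \<phi> = cnj c *s pc a \<phi>"
  by (simp add: pc_def vec2_eq_iff algebra_simps)

lemma onpair_expand:
  assumes "onpair b b'"
  shows "v = cinner b v *s b + cinner b' v *s b'"
proof -
  have "v = (proj b + proj b') *v v" by (simp add: onpair_proj_sum[OF assms])
  then show ?thesis by (simp add: matrix_vector_mult_add_rdistrib proj_mult_vec)
qed

lemma pc_expand:
  assumes "onpair a a'"
  shows "\<phi> = tensor a (pc a \<phi>) + tensor a' (pc a' \<phi>)"
proof -
  have *: "a $ i * cnj (a $ j) + a' $ i * cnj (a' $ j) = (if i = j then 1 else 0)" for i j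
    using arg_cong[OF onpair_proj_sum[OF assms], of "\<lambda>M. M $ i $ j"] by (simp add: proj_def mat_def)
  have "(tensor a (pc a \<phi>) + tensor a' (pc a' \<phi>)) $ (i, q) =
      (a $ i * cnj (a $ 1) + a' $ i * cnj (a' $ 1)) * \<phi> $ (1, q) +
      (a $ i * cnj (a $ 2) + a' $ i * cnj (a' $ 2)) * \<phi> $ (2, q)" for i q
    by (simp add: pc_def algebra_simps)
  then have "(tensor a (pc a \<phi>) + tensor a' (pc a' \<phi>)) $ (i, q) = \<phi> $ (i, q)" for i q
    using exhaust_2[of i] unfolding * by auto
  then show ?thesis by (simp add: vec22_eq_iff)
qed

text \<open>In the expansion along \<open>a\<close> and \<open>perp a\<close> only the second term
  survives. The scalar from normalising \<open>a\<close> is absorbed into \<open>c\<close>.\<close>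

lemma pc_eq_0_imp_product:
  assumes "a \<noteq> 0" "pc a \<phi> = 0"
  obtains c where "\<phi> = tensor (perp a) c"
proof -
  obtain r v where v: "r > 0" "v = complex_of_real r *s a" "cinner v v = 1"
    using obtain_unit[OF assms(1)] .
  have "pc v \<phi> = 0" by (simp add: v(2) pc_scale assms)
  then have "\<phi> = tensor (perp v) (pc (perp v) \<phi>)"
    using pc_expand[OF onpair_perp[OF v(3)], of \<phi>] by (simp add: vec22_eq_iff)
  also have "\<dots> = tensor (perp a) (complex_of_real r *s pc (perp v) \<phi>)"
    by (simp add: vec22_eq_iff v(2) perp_def)
  finally show thesis by (rule that)
qed

text \<open>The vector \<open>tensor a b'\<close> is orthogonal to \<open>\<psi> k\<close> and
  \<open>\<psi> l\<close>, hence lies in the span of \<open>\<psi> i\<close> and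
  \<open>\<psi> j\<close>, while \<open>tensor a b\<close> is orthogonal to that span. The remaining
  dimension of the span has no component along \<open>a\<close> on Alice's side, so it is a product
  as well.\<close>

lemma pairing_split:
  assumes onb: "onb \<psi>" and ij: "i \<in> idx" "j \<in> idx" "i \<noteq> j"
    and kl: "k \<noteq> l" "idx - {i, j} = {k, l}"
    and ne: "a \<noteq> 0" "b \<noteq> 0" "b' \<noteq> 0"
    and b: "cinner (tensor a b) (\<psi> i) = 0" "cinner (tensor a b) (\<psi> j) = 0"
    and b': "cinner (tensor a b') (\<psi> k) = 0" "cinner (tensor a b') (\<psi> l) = 0"
  shows "separable_pair_split \<psi>"
proof -
  obtain r\<^sub>1 u where u: "r\<^sub>1 > 0" "u = complex_of_real r\<^sub>1 *s a" "cinner u u = 1"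
    using obtain_unit[OF ne(1)] .
  obtain r\<^sub>2 v where v: "r\<^sub>2 > 0" "v = complex_of_real r\<^sub>2 *s b" "cinner v v = 1"
    using obtain_unit[OF ne(2)] .
  obtain r\<^sub>3 v' where v': "r\<^sub>3 > 0" "v' = complex_of_real r\<^sub>3 *s b'" "cinner v' v' = 1"
    using obtain_unit[OF ne(3)] .
  have t: "tensor u v = (complex_of_real r\<^sub>1 * complex_of_real r\<^sub>2) *s tensor a b"
    "tensor u v' = (complex_of_real r\<^sub>1 * complex_of_real r\<^sub>3) *s tensor a b'"
    by (simp_all add: vec22_eq_iff u v v')
  have o: "cinner (tensor u v) (\<psi> i) = 0" "cinner (tensor u v) (\<psi> j) = 0"
    "cinner (tensor u v') (\<psi> k) = 0" "cinner (tensor u v') (\<psi> l) = 0"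
    using b b' by (simp_all add: t cinner_linear)
  define \<alpha> where "\<alpha> = cinner (\<psi> i) (tensor u v')"
  define \<beta> where "\<beta> = cinner (\<psi> j) (tensor u v')"
  have idx: "idx = {i, j, k, l}" using ij kl by blast
  have dist: "k \<noteq> i" "k \<noteq> j" "l \<noteq> i" "l \<noteq> j" using kl by auto
  have e2: "tensor u v' = \<alpha> *s \<psi> i + \<beta> *s \<psi> j"
    using onb_expand[OF onb, of "tensor u v'"] ij kl dist o
      cinner_commute[of "\<psi> k" "tensor u v'"] cinner_commute[of "\<psi> l" "tensor u v'"]
    by (simp add: idx \<alpha>_def \<beta>_def)
  \<comment> \<open>The two vectors share the unit factor \<open>u\<close>, so their orthogonality
    is that of \<open>v\<close> and \<open>v'\<close>.\<close>
  have "cinner (tensor u v) (tensor u v') = 0"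
    unfolding e2 by (simp add: cinner_linear o)
  then have on: "onpair v v'" using u v v' by (simp add: cinner_tensor onpair_def)
  have nrm: "\<alpha> * cnj \<alpha> + \<beta> * cnj \<beta> = 1"
  proof -
    have "cinner (tensor u v') (tensor u v') = 1" using u v' by (simp add: cinner_tensor)
    then show ?thesis
      using onbD[OF onb] ij unfolding e2 by (auto simp: cinner_linear algebra_simps)
  qed
  \<comment> \<open>The unit vector of the span of \<open>\<psi> i\<close>, \<open>\<psi> j\<close>
    that is orthogonal to \<open>tensor u v'\<close>.\<close>
  define f where "f = (- cnj \<beta>) *s \<psi> i + cnj \<alpha> *s \<psi> j"
  have ff: "cinner f f = 1"
    using onbD[OF onb] ij nrm by (auto simp: f_def cinner_linear algebra_simps)
  have "cinner (tensor u v) f = 0" by (simp add: f_def cinner_linear o)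
  moreover have "cinner (tensor u v') f = 0"
    unfolding e2 using onbD[OF onb] ij by (auto simp: f_def cinner_linear algebra_simps)
  ultimately have "pc u f = 0"
    using onpair_expand[OF on, of "pc u f"] by (simp add: cinner_tensor_pc)
  moreover have "u \<noteq> 0" using u(3) by (auto simp: cinner_linear)
  ultimately obtain d where d: "f = tensor (perp u) d" using pc_eq_0_imp_product by blast
  have onu: "onpair u (perp u)" by (rule onpair_perp) (rule u)
  then have "onpair d (perp d)"
    using ff by (intro onpair_perp) (simp add: d cinner_tensor onpair_def)
  \<comment> \<open>The passage from \<open>\<psi> i\<close>, \<open>\<psi> j\<close> to
    \<open>tensor u v'\<close>, \<open>f\<close> is a unitary change of basis, so the projector onto
    the span is unchanged.\<close>
  moreover have "proj (\<psi> i) + proj (\<psi> j) = proj (tensor u v') + proj (tensor (perp u) d)"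
  proof -
    have "(proj (tensor u v') + proj f) $ p $ q =
        (\<alpha> * cnj \<alpha> + \<beta> * cnj \<beta>) * (proj (\<psi> i) + proj (\<psi> j)) $ p $ q" for p q
      unfolding e2 f_def by (simp add: proj_def algebra_simps)
    then show ?thesis unfolding d nrm by (simp add: vec_eq_iff)
  qed
  ultimately show ?thesis
    using separable_pair_splitI[OF onb ij onu onpair_commute[OF on]] by blast
qed

section \<open>Local discrimination of two orthogonal states\<close>

text \<open>A traceless matrix with entries \<open>m, z, w, -m\<close> has a vector with zero expectation.\<close>

lemma exists_isotropic:
  fixes m z w :: complex
  obtains a :: qvec where "a \<noteq> 0"
    "m * (a $ 1 * cnj (a $ 1)) + z * (a $ 1 * cnj (a $ 2)) + w * (a $ 2 * cnj (a $ 1)) = m * (a $ 2 * cnj (a $ 2))"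
proof (cases "m = 0")
  case True
  show thesis
    by (rule that[of "\<chi> i. if i = 1 then 1 else 0"]) (auto simp: True vec_eq_iff)
next
  case False
  define z' w' where "z' = z / m" and "w' = w / m"
  \<comment> \<open>The phase \<open>e\<close> makes \<open>z' * cnj e + w' * e\<close> real: it
    turns the non-Hermitian part \<open>z' - cnj w'\<close> into a real number, and what remains is
    a number plus its conjugate. If that part vanishes, any phase works.\<close>
  define e where "e = (if z' = cnj w' then 1 else sgn (z' - cnj w'))"
  have e1: "e * cnj e = 1"
    by (auto simp: e_def complex_norm_square[symmetric] norm_sgn)
  have "y * cnj (sgn y) \<in> \<real>" for y :: complex
    by (simp add: sgn_eq complex_is_Real_iff)
  then have "(z' - cnj w') * cnj e \<in> \<real>"
    unfolding e_def by (cases "z' = cnj w'") (simp_all del: complex_cnj_diff)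
  moreover have "z' * cnj e + w' * e = (z' - cnj w') * cnj e + (cnj (w' * e) + w' * e)"
    by (simp add: algebra_simps)
  moreover have "cnj (w' * e) + w' * e \<in> \<real>"
    by (simp add: complex_is_Real_iff)
  ultimately have "z' * cnj e + w' * e \<in> \<real>" by (metis Reals_add)
  then obtain t where t: "z' * cnj e + w' * e = complex_of_real t" by (auto elim: Reals_cases)
  \<comment> \<open>For the vector with entries \<open>x\<close> and \<open>e\<close> the condition
    becomes the real equation \<open>x * x + t * x - 1 = 0\<close>, whose discriminant is
    positive.\<close>
  define x where "x = (- t + sqrt (t^2 + 4)) / 2"
  have "sqrt (t^2 + 4) * sqrt (t^2 + 4) = t^2 + 4" by simp
  then have x: "x * x + t * x - 1 = 0"
    by (simp add: x_def field_simps power2_eq_square)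
  define a :: qvec where "a = (\<chi> i. if i = 1 then complex_of_real x else e)"
  have "a $ 1 * cnj (a $ 1) + z' * (a $ 1 * cnj (a $ 2)) + w' * (a $ 2 * cnj (a $ 1)) - a $ 2 * cnj (a $ 2)
      = of_real x * of_real x + (z' * cnj e + w' * e) * of_real x - e * cnj e"
    by (simp add: a_def algebra_simps)
  also have "\<dots> = complex_of_real (x * x + t * x - 1)" by (simp add: t e1)
  finally have "a $ 1 * cnj (a $ 1) + z' * (a $ 1 * cnj (a $ 2)) + w' * (a $ 2 * cnj (a $ 1)) = a $ 2 * cnj (a $ 2)"
    by (simp add: x)
  then have "m * (a $ 1 * cnj (a $ 1) + z' * (a $ 1 * cnj (a $ 2)) + w' * (a $ 2 * cnj (a $ 1))) = m * (a $ 2 * cnj (a $ 2))"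
    by simp
  moreover have "a \<noteq> 0" using e1 by (auto simp: a_def vec_eq_iff forall_2)
  ultimately show thesis
    using False by (intro that[of a]) (auto simp: z'_def w'_def algebra_simps)
qed

text \<open>The basis is aligned with \<open>x\<close>: its first vector is parallel to
  \<open>x\<close>, hence orthogonal to \<open>y\<close>, and its second is orthogonal to
  \<open>x\<close>. For \<open>x = 0\<close> any basis will do.\<close>

lemma onpair_separating:
  assumes "cinner x y = 0"
  obtains b b' where "onpair b b'" "cinner b x = 0 \<or> cinner b y = 0" "cinner b' x = 0 \<or> cinner b' y = 0"
proof (cases "x = 0")
  case True
  have "onpair (axis 1 1) (perp (axis 1 1))"
    by (rule onpair_perp) (simp add: cinner_def sum_2 axis_def)
  then show thesis using that True by (auto simp: cinner_linear)
next
  case False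
  then obtain r b where b: "r > 0" "b = complex_of_real r *s x" "cinner b b = 1"
    by (rule obtain_unit)
  have on: "onpair b (perp b)" using b by (intro onpair_perp)
  have "complex_of_real r * cinner (perp b) x = 0"
    using onpair_commute[OF on] by (simp add: onpair_def b(2) cinner_linear)
  then show thesis
    using that[OF on] b assms by (simp add: b(2) cinner_linear)
qed

lemma cinner_pc_sum:
  assumes "onpair a a'"
  shows "cinner (pc a \<phi>) (pc a \<eta>) + cinner (pc a' \<phi>) (pc a' \<eta>) = cinner \<phi> \<eta>"
proof -
  have "cinner \<phi> \<eta> = cinner (tensor a (pc a \<phi>) + tensor a' (pc a' \<phi>)) \<eta>"
    using pc_expand[OF assms, of \<phi>] by simp
  then show ?thesis by (simp add: cinner_linear cinner_tensor_pc)
qed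

text \<open>If Bob's residual states for \<open>a\<close> are orthogonal, then so are those for \<open>perp a\<close>.\<close>

lemma two_states_distinguishable:
  assumes "cinner \<phi> \<eta> = 0"
  obtains Ks where "locc_kraus Ks" "\<And>K. K \<in> set Ks \<Longrightarrow> K *v \<phi> = 0 \<or> K *v \<eta> = 0"
proof -
  let ?n = "\<lambda>p p'. \<Sum>q\<in>UNIV. cnj (\<phi> $ (p, q)) * \<eta> $ (p', q)"
  obtain a :: qvec where a: "a \<noteq> 0" "?n 1 1 * (a $ 1 * cnj (a $ 1)) + ?n 1 2 * (a $ 1 * cnj (a $ 2))
      + ?n 2 1 * (a $ 2 * cnj (a $ 1)) = ?n 1 1 * (a $ 2 * cnj (a $ 2))"
    using exists_isotropic .
  \<comment> \<open>The trace of the matrix \<open>?n\<close> is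
    \<open>cinner \<phi> \<eta>\<close>, so orthogonality supplies the tracelessness behind
    \<open>exists_isotropic\<close>.\<close>
  have "?n 2 2 = - ?n 1 1"
    using assms by (simp add: cinner_def sum_22 sum_2 add_eq_0_iff algebra_simps)
  moreover have "cinner (pc a \<phi>) (pc a \<eta>) = ?n 1 1 * (a $ 1 * cnj (a $ 1)) + ?n 1 2 * (a $ 1 * cnj (a $ 2))
      + ?n 2 1 * (a $ 2 * cnj (a $ 1)) + ?n 2 2 * (a $ 2 * cnj (a $ 2))"
    by (simp add: cinner_def pc_def sum_2 algebra_simps)
  ultimately have z: "cinner (pc a \<phi>) (pc a \<eta>) = 0" using a(2) by simp
  obtain r u where u: "r > 0" "u = complex_of_real r *s a" "cinner u u = 1"
    using obtain_unit[OF a(1)] .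
  have on: "onpair u (perp u)" using u by (intro onpair_perp)
  have z1: "cinner (pc u \<phi>) (pc u \<eta>) = 0" using z by (simp add: u(2) pc_scale cinner_linear)
  then have z2: "cinner (pc (perp u) \<phi>) (pc (perp u) \<eta>) = 0"
    using cinner_pc_sum[OF on, of \<phi> \<eta>] assms by simp
  obtain b b' where b: "onpair b b'" "cinner b (pc u \<phi>) = 0 \<or> cinner b (pc u \<eta>) = 0"
    "cinner b' (pc u \<phi>) = 0 \<or> cinner b' (pc u \<eta>) = 0"
    using onpair_separating[OF z1] .
  obtain d d' where d: "onpair d d'" "cinner d (pc (perp u) \<phi>) = 0 \<or> cinner d (pc (perp u) \<eta>) = 0"
    "cinner d' (pc (perp u) \<phi>) = 0 \<or> cinner d' (pc (perp u) \<eta>) = 0"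
    using onpair_separating[OF z2] .
  obtain Ks where Ks: "locc_kraus Ks" "set Ks = {kron (proj u) (proj b), kron (proj u) (proj b'),
      kron (proj (perp u)) (proj d), kron (proj (perp u)) (proj d')}"
    using locc_kraus_onpairs[OF on b(1) d(1)] .
  show thesis
    using b d kron_proj_kills
    by (intro that[OF Ks(1)]) (unfold Ks(2) cinner_tensor_pc[symmetric], blast)
qed

section \<open>The last invertible step of a protocol\<close>

text \<open>The determinant of the two vectors, bilinear without conjugation; it is nonzero exactly
  when they are linearly independent.\<close>

definition wedge :: "qvec \<Rightarrow> qvec \<Rightarrow> complex" where
  "wedge u v = u $ 1 * v $ 2 - u $ 2 * v $ 1"

definition nonsing :: "qop \<Rightarrow> bool" where
  "nonsing A \<longleftrightarrow> (\<forall>v. A *v v = 0 \<longrightarrow> v = 0)"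

text \<open>Only the direction \<open>a\<close> is recorded, since it decides which vectors are
  annihilated; the output vector \<open>u\<close> changes in later rounds.\<close>

definition rank_one :: "qop \<Rightarrow> qvec \<Rightarrow> bool" where
  "rank_one A a \<longleftrightarrow> a \<noteq> 0 \<and> (\<exists>u. u \<noteq> 0 \<and> (\<forall>v. A *v v = cinner a v *s u))"

lemma mult_vec_2: "(A *v v) $ i = A $ i $ 1 * v $ 1 + A $ i $ 2 * v $ 2" for A :: qop
  by (simp add: matrix_vector_mult_def sum_2)

lemma sum_list_mult_vec: "sum_list (map f xs) *v v = sum_list (map (\<lambda>x. f x *v v) xs)"
  for f :: "'b \<Rightarrow> complex ^ 'n ^ 'm"
  by (induction xs) (simp_all add: matrix_vector_mult_add_rdistrib)

text \<open>By completeness of the instrument, \<open>v\<close> is the sum of the vectors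
  \<open>cadj A *v (A *v v)\<close>, which cannot all vanish.\<close>

lemma local_instr_nonzero:
  assumes "local_instr F" "v \<noteq> 0"
  obtains A where "A \<in> set F" "A *v v \<noteq> 0"
proof -
  have "v = sum_list (map (\<lambda>A. cadj A ** A) F) *v v" using assms by (simp add: local_instr_def)
  also have "\<dots> = sum_list (map (\<lambda>A. cadj A *v (A *v v)) F)"
    by (simp add: sum_list_mult_vec matrix_vector_mul_assoc)
  finally have v: "v = sum_list (map (\<lambda>A. cadj A *v (A *v v)) F)" .
  have "\<exists>A\<in>set F. A *v v \<noteq> 0"
  proof (rule ccontr)
    assume "\<not> (\<exists>A\<in>set F. A *v v \<noteq> 0)"
    then have "map (\<lambda>A. cadj A *v (A *v v)) F = map (\<lambda>A. 0) F" by simp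
    then have "sum_list (map (\<lambda>A. cadj A *v (A *v v)) F) = 0" by (simp only: sum_list_0)
    with v assms(2) show False by metis
  qed
  then show thesis using that by blast
qed

text \<open>In dimension two a nonzero operator that kills \<open>w\<close> factors through the
  functional vanishing on \<open>w\<close>, which is \<open>cinner (perp w)\<close>.\<close>

lemma rank_one_perp:
  assumes "w \<noteq> 0" "A *v w = 0" "A *v v \<noteq> 0"
  shows "rank_one A (perp w)"
proof -
  have w: "A $ i $ 1 * w $ 1 + A $ i $ 2 * w $ 2 = 0" for i
    using assms(2) by (metis mult_vec_2 zero_index)
  \<comment> \<open>Read off from \<open>A *v x = (w $ 1 * x $ 2 - w $ 2 * x $ 1) *s u\<close>,
    dividing by an entry of \<open>w\<close> that is nonzero.\<close>
  define u :: qvec where "u = (if w $ 1 \<noteq> 0 then \<chi> i. A $ i $ 2 / w $ 1 else \<chi> i. - (A $ i $ 1 / w $ 2))"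
  have w2: "w $ 1 = 0 \<Longrightarrow> w $ 2 \<noteq> 0" using assms(1) by (auto simp: vec2_eq_iff)
  have eq: "A *v x = cinner (perp w) x *s u" for x
  proof -
    have "A $ i $ 1 * x $ 1 + A $ i $ 2 * x $ 2 = (w $ 1 * x $ 2 - w $ 2 * x $ 1) * u $ i" for i
    proof (cases "w $ 1 = 0")
      case True
      then have "A $ i $ 2 = 0" using w2 w[of i] by simp
      then show ?thesis using True w2 by (simp add: u_def)
    next
      case False
      then have u: "A $ i $ 2 = u $ i * w $ 1" by (simp add: u_def)
      have "w $ 1 * (A $ i $ 1 * x $ 1 + A $ i $ 2 * x $ 2) =
          (A $ i $ 1 * w $ 1 + A $ i $ 2 * w $ 2) * x $ 1 + A $ i $ 2 * (w $ 1 * x $ 2 - w $ 2 * x $ 1)"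
        by (simp add: algebra_simps)
      also have "\<dots> = A $ i $ 2 * (w $ 1 * x $ 2 - w $ 2 * x $ 1)"
        by (simp only: w mult_zero_left add_0_left)
      also have "\<dots> = w $ 1 * ((w $ 1 * x $ 2 - w $ 2 * x $ 1) * u $ i)"
        by (simp only: u mult_ac)
      finally have "w $ 1 * (A $ i $ 1 * x $ 1 + A $ i $ 2 * x $ 2) =
          w $ 1 * ((w $ 1 * x $ 2 - w $ 2 * x $ 1) * u $ i)" .
      then show ?thesis using False by simp
    qed
    then show ?thesis
      by (simp add: vec_eq_iff mult_vec_2 cinner_def perp_def sum_2 algebra_simps)
  qed
  have "u \<noteq> 0" using assms(3) eq[of v] by (auto simp: vec_eq_iff)
  moreover have "perp w \<noteq> 0" using assms(1) by (auto simp: perp_def vec2_eq_iff)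
  ultimately show ?thesis using eq unfolding rank_one_def by blast
qed

text \<open>If all operators are singular, choose a nonzero one with kernel vector \<open>w\<close>.
  By completeness some other operator does not kill \<open>w\<close>, so the two kernels, and hence
  the two directions, are independent.\<close>

lemma local_instr_dichotomy:
  assumes "local_instr F"
  obtains A where "A \<in> set F" "nonsing A"
  | A A' a a' where "A \<in> set F" "A' \<in> set F" "rank_one A a" "rank_one A' a'" "wedge a a' \<noteq> 0"
proof (cases "\<exists>A\<in>set F. nonsing A")
  case True
  then show thesis using that(1) by blast
next
  case False
  have ker: "\<exists>w. w \<noteq> 0 \<and> A *v w = 0" if "A \<in> set F" for A
    using False that unfolding nonsing_def by blast
  have "axis 1 1 \<noteq> (0 :: qvec)" by (simp add: axis_eq_0_iff)
  then obtain A where A: "A \<in> set F" "A *v axis 1 1 \<noteq> 0"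
    using local_instr_nonzero[OF assms] by blast
  obtain w where w: "w \<noteq> 0" "A *v w = 0" using ker[OF A(1)] by blast
  obtain A' where A': "A' \<in> set F" "A' *v w \<noteq> 0"
    using local_instr_nonzero[OF assms w(1)] by blast
  obtain w' where w': "w' \<noteq> 0" "A' *v w' = 0" using ker[OF A'(1)] by blast
  have r: "rank_one A' (perp w')" using rank_one_perp[OF w' A'(2)] .
  then have "cinner (perp w') w \<noteq> 0" using A'(2) by (auto simp: rank_one_def)
  moreover have "wedge (perp w) (perp w') = - cnj (cinner (perp w') w)"
    by (simp add: wedge_def perp_def cinner_def sum_2)
  ultimately have "wedge (perp w) (perp w') \<noteq> 0" by simp
  then show thesis using that(2) A A' r rank_one_perp[OF w A(2)] by blast
qed

lemma nonsing_iff: "nonsing X \<longleftrightarrow> X $ 1 $ 1 * X $ 2 $ 2 - X $ 1 $ 2 * X $ 2 $ 1 \<noteq> 0"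
proof
  assume X: "nonsing X"
  show "X $ 1 $ 1 * X $ 2 $ 2 - X $ 1 $ 2 * X $ 2 $ 1 \<noteq> 0"
  proof
    assume d: "X $ 1 $ 1 * X $ 2 $ 2 - X $ 1 $ 2 * X $ 2 $ 1 = 0"
    have ker: "p = 0 \<and> q = 0"
      if "X $ 1 $ 1 * p + X $ 1 $ 2 * q = 0" "X $ 2 $ 1 * p + X $ 2 $ 2 * q = 0" for p q
    proof -
      define v :: qvec where "v = (\<chi> i. if i = 1 then p else q)"
      have v: "v $ 1 = p" "v $ 2 = q" by (simp_all add: v_def)
      have "X *v v = 0" using that by (simp only: vec2_eq_iff mult_vec_2 v zero_index simp_thms)
      then have "v = 0" using X unfolding nonsing_def by blast
      then show ?thesis using v by simp
    qed
    note comm = mult.commute[of "X $ 2 $ 1" "X $ 2 $ 2"] mult.commute[of "X $ 1 $ 2" "X $ 1 $ 1"]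
      mult.commute[of "X $ 2 $ 2" "X $ 1 $ 1"] mult.commute[of "X $ 2 $ 1" "X $ 1 $ 2"]
    \<comment> \<open>For vanishing determinant the columns of the adjugate lie in the kernel. Hence
      all entries of \<open>X\<close> are zero, and the vector with entries 1 and 0 is killed
      too.\<close>
    have "X $ 2 $ 2 = 0 \<and> - X $ 2 $ 1 = 0" using d by (intro ker) (simp_all add: comm)
    moreover have "X $ 1 $ 2 = 0 \<and> - X $ 1 $ 1 = 0" using d by (intro ker) (simp_all add: comm)
    ultimately have "(1::complex) = 0 \<and> (0::complex) = 0" by (intro ker) simp_all
    then show False by simp
  qed
next
  assume d: "X $ 1 $ 1 * X $ 2 $ 2 - X $ 1 $ 2 * X $ 2 $ 1 \<noteq> 0"
  show "nonsing X" unfolding nonsing_def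
  proof (intro allI impI)
    fix v assume "X *v v = 0"
    then have e: "X $ 1 $ 1 * v $ 1 + X $ 1 $ 2 * v $ 2 = 0" "X $ 2 $ 1 * v $ 1 + X $ 2 $ 2 * v $ 2 = 0"
      by (metis mult_vec_2 zero_index)+
    have "(X $ 1 $ 1 * X $ 2 $ 2 - X $ 1 $ 2 * X $ 2 $ 1) * v $ 1 =
        X $ 2 $ 2 * (X $ 1 $ 1 * v $ 1 + X $ 1 $ 2 * v $ 2) - X $ 1 $ 2 * (X $ 2 $ 1 * v $ 1 + X $ 2 $ 2 * v $ 2)"
      "(X $ 1 $ 1 * X $ 2 $ 2 - X $ 1 $ 2 * X $ 2 $ 1) * v $ 2 =
        X $ 1 $ 1 * (X $ 2 $ 1 * v $ 1 + X $ 2 $ 2 * v $ 2) - X $ 2 $ 1 * (X $ 1 $ 1 * v $ 1 + X $ 1 $ 2 * v $ 2)"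
      by (simp_all add: algebra_simps)
    then show "v = 0" using d by (simp add: e vec2_eq_iff)
  qed
qed

lemma nonsing_cadj:
  assumes "nonsing X"
  shows "nonsing (cadj X)"
proof -
  have "cadj X $ 1 $ 1 * cadj X $ 2 $ 2 - cadj X $ 1 $ 2 * cadj X $ 2 $ 1 =
      cnj (X $ 1 $ 1 * X $ 2 $ 2 - X $ 1 $ 2 * X $ 2 $ 1)"
    by (simp add: cadj_def)
  then show ?thesis using assms by (metis nonsing_iff complex_cnj_zero_iff)
qed

lemma nonsing_mult: "nonsing A \<Longrightarrow> nonsing B \<Longrightarrow> nonsing (A ** B)"
  unfolding nonsing_def matrix_vector_mul_assoc[symmetric] by blast

lemma nonsing_mat_1: "nonsing (mat 1)"
  by (simp add: nonsing_def)

text \<open>A later instrument of the same party acts on the output \<open>u\<close> only, and by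
  completeness some outcome does not kill it; the direction stays \<open>a\<close>.\<close>

lemma rank_one_mult_left:
  assumes "rank_one A a" "local_instr F"
  obtains X where "X \<in> set F" "rank_one (X ** A) a"
proof -
  obtain u where u: "a \<noteq> 0" "u \<noteq> 0" "\<And>v. A *v v = cinner a v *s u"
    using assms(1) unfolding rank_one_def by blast
  obtain X where X: "X \<in> set F" "X *v u \<noteq> 0" using local_instr_nonzero[OF assms(2) u(2)] .
  have "(X ** A) *v v = cinner a v *s (X *v u)" for v
    by (simp add: matrix_vector_mul_assoc[symmetric] u(3) vector_scalar_commute)
  then show thesis using that[OF X(1)] X(2) u(1) unfolding rank_one_def by blast
qed

text \<open>An invertible operator applied before the projection moves to the other side of the
  inner product as its adjoint.\<close>

lemma rank_one_nonsing_right: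
  assumes "rank_one A a" "nonsing X"
  shows "rank_one (A ** X) (cadj X *v a)"
proof -
  obtain u where u: "a \<noteq> 0" "u \<noteq> 0" "\<And>v. A *v v = cinner a v *s u"
    using assms(1) unfolding rank_one_def by blast
  have "cadj X *v a \<noteq> 0" using nonsing_cadj[OF assms(2)] u(1) unfolding nonsing_def by blast
  moreover have "(A ** X) *v v = cinner (cadj X *v a) v *s u" for v
    using cinner_adj[of v X a] cinner_commute[of a "X *v v"] cinner_commute[of "cadj X *v a" v]
    by (simp add: matrix_vector_mul_assoc[symmetric] u(3))
  ultimately show ?thesis using u(2) unfolding rank_one_def by blast
qed

lemma wedge_cadj:
  assumes "wedge a a' \<noteq> 0" "nonsing X"
  shows "wedge (cadj X *v a) (cadj X *v a') \<noteq> 0"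
proof -
  have "wedge (cadj X *v a) (cadj X *v a') = cnj (X $ 1 $ 1 * X $ 2 $ 2 - X $ 1 $ 2 * X $ 2 $ 1) * wedge a a'"
    by (simp add: wedge_def mult_vec_2 cadj_def algebra_simps)
  then show ?thesis using assms by (auto simp: nonsing_iff simp flip: complex_cnj_mult complex_cnj_diff)
qed

text \<open>The leaves reached after Alice has projected onto \<open>a\<close>: either Bob has not yet
  projected, or he does so in at least two different directions.\<close>

definition alice_dir :: "top set \<Rightarrow> qvec \<Rightarrow> bool" where
  "alice_dir S a \<longleftrightarrow> (\<exists>A B. kron A B \<in> S \<and> rank_one A a \<and> nonsing B) \<or>
     (\<exists>A B A' B' b b'. kron A B \<in> S \<and> kron A' B' \<in> S \<and> rank_one A a \<and> rank_one A' a \<and>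
        rank_one B b \<and> rank_one B' b' \<and> wedge b b' \<noteq> 0)"

definition alice_split :: "top set \<Rightarrow> bool" where
  "alice_split S \<longleftrightarrow> (\<exists>a a'. wedge a a' \<noteq> 0 \<and> alice_dir S a \<and> alice_dir S a')"

definition has_nonsing :: "top set \<Rightarrow> bool" where
  "has_nonsing S \<longleftrightarrow> (\<exists>A B. kron A B \<in> S \<and> nonsing A \<and> nonsing B)"

text \<open>One round, seen on sets of leaves. The invariants assert that certain leaves exist, so
  an inclusion into \<open>S'\<close> suffices.\<close>

definition alice_step :: "top set \<Rightarrow> top set \<Rightarrow> bool" where
  "alice_step S S' \<longleftrightarrow> (\<forall>K\<in>S. \<exists>F. local_instr F \<and> (\<forall>A\<in>set F. kron A (mat 1) ** K \<in> S'))"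

definition bob_step :: "top set \<Rightarrow> top set \<Rightarrow> bool" where
  "bob_step S S' \<longleftrightarrow> (\<forall>K\<in>S. \<exists>F. local_instr F \<and> (\<forall>B\<in>set F. kron (mat 1) B ** K \<in> S'))"

lemma alice_stepE:
  assumes "alice_step S S'" "kron A B \<in> S"
  obtains F where "local_instr F" "\<And>X. X \<in> set F \<Longrightarrow> kron (X ** A) B \<in> S'"
proof -
  obtain F where "local_instr F" "\<forall>X\<in>set F. kron X (mat 1) ** kron A B \<in> S'"
    using assms unfolding alice_step_def by blast
  then show thesis by (intro that[of F]) (auto simp: kron_mult)
qed

lemma bob_stepE:
  assumes "bob_step S S'" "kron A B \<in> S"
  obtains F where "local_instr F" "\<And>X. X \<in> set F \<Longrightarrow> kron A (X ** B) \<in> S'"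
proof -
  obtain F where "local_instr F" "\<forall>X\<in>set F. kron (mat 1) X ** kron A B \<in> S'"
    using assms unfolding bob_step_def by blast
  then show thesis by (intro that[of F]) (auto simp: kron_mult)
qed

text \<open>By the dichotomy, either an invertible leaf survives or Alice projects onto two
  independent directions while Bob's operator is still invertible.\<close>

lemma alice_step_has_nonsing:
  assumes "alice_step S S'" "has_nonsing S"
  shows "has_nonsing S' \<or> alice_split S'"
proof -
  obtain A B where AB: "kron A B \<in> S" "nonsing A" "nonsing B"
    using assms(2) unfolding has_nonsing_def by blast
  obtain F where F: "local_instr F" "\<And>X. X \<in> set F \<Longrightarrow> kron (X ** A) B \<in> S'"
    using alice_stepE[OF assms(1) AB(1)] by blast
  from F(1) show ?thesis
  proof (cases rule: local_instr_dichotomy)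
    case (1 X)
    then show ?thesis using F(2) AB nonsing_mult unfolding has_nonsing_def by blast
  next
    case (2 X X' a a')
    have "alice_dir S' (cadj A *v a)" "alice_dir S' (cadj A *v a')"
      using 2 F(2) AB rank_one_nonsing_right unfolding alice_dir_def by blast+
    then show ?thesis using wedge_cadj[OF 2(5) AB(2)] unfolding alice_split_def by blast
  qed
qed

lemma alice_step_alice_dir:
  assumes "alice_step S S'" "alice_dir S a"
  shows "alice_dir S' a"
proof -
  have step: "\<exists>A'. kron A' B \<in> S' \<and> rank_one A' a" if h: "kron A B \<in> S" "rank_one A a" for A B
  proof -
    obtain F where F: "local_instr F" "\<And>X. X \<in> set F \<Longrightarrow> kron (X ** A) B \<in> S'"
      using alice_stepE[OF assms(1) h(1)] by blast
    show ?thesis using rank_one_mult_left[OF h(2) F(1)] F(2) by blast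
  qed
  from assms(2) consider A B where "kron A B \<in> S" "rank_one A a" "nonsing B"
    | A B A' B' b b' where "kron A B \<in> S" "kron A' B' \<in> S" "rank_one A a" "rank_one A' a"
        "rank_one B b" "rank_one B' b'" "wedge b b' \<noteq> 0"
    unfolding alice_dir_def by blast
  then show ?thesis
  proof cases
    case 1
    then show ?thesis using step[OF 1(1,2)] unfolding alice_dir_def by blast
  next
    case 2
    obtain C C' where "kron C B \<in> S'" "rank_one C a" "kron C' B' \<in> S'" "rank_one C' a"
      using step[OF 2(1,3)] step[OF 2(2,4)] by blast
    then show ?thesis using 2 unfolding alice_dir_def by blast
  qed
qed

text \<open>If Bob's operator is invertible, the dichotomy keeps it so or produces two independent
  directions. Once he has two directions, further instruments of his preserve them.\<close>

lemma bob_step_alice_dir: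
  assumes "bob_step S S'" "alice_dir S a"
  shows "alice_dir S' a"
proof -
  from assms(2) consider A B where "kron A B \<in> S" "rank_one A a" "nonsing B"
    | A B A' B' b b' where "kron A B \<in> S" "kron A' B' \<in> S" "rank_one A a" "rank_one A' a"
        "rank_one B b" "rank_one B' b'" "wedge b b' \<noteq> 0"
    unfolding alice_dir_def by blast
  then show ?thesis
  proof cases
    case 1
    obtain F where F: "local_instr F" "\<And>X. X \<in> set F \<Longrightarrow> kron A (X ** B) \<in> S'"
      using bob_stepE[OF assms(1) 1(1)] by blast
    from F(1) show ?thesis
    proof (cases rule: local_instr_dichotomy)
      case X: (1 X)
      then show ?thesis using F(2) 1 nonsing_mult unfolding alice_dir_def by blast
    next
      case X: (2 X X' b b')
      have "rank_one (X ** B) (cadj B *v b)" "rank_one (X' ** B) (cadj B *v b')"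
        "wedge (cadj B *v b) (cadj B *v b') \<noteq> 0"
        using X 1 rank_one_nonsing_right wedge_cadj by blast+
      then show ?thesis using F(2) X 1 unfolding alice_dir_def by blast
    qed
  next
    case 2
    have step: "\<exists>B'. kron A B' \<in> S' \<and> rank_one B' b" if h: "kron A B \<in> S" "rank_one B b" for A B b
    proof -
      obtain F where F: "local_instr F" "\<And>X. X \<in> set F \<Longrightarrow> kron A (X ** B) \<in> S'"
        using bob_stepE[OF assms(1) h(1)] by blast
      show ?thesis using rank_one_mult_left[OF h(2) F(1)] F(2) by blast
    qed
    obtain C C' where "kron A C \<in> S'" "rank_one C b" "kron A' C' \<in> S'" "rank_one C' b'"
      using step[OF 2(1,5)] step[OF 2(2,6)] by blast
    then show ?thesis using 2 unfolding alice_dir_def by blast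
  qed
qed

text \<open>The invariant of the induction over rounds: an invertible leaf remains, or the leaves
  below a last invertible branch show a split by Alice or, after exchange, by Bob.\<close>

definition protocol_shape :: "top set \<Rightarrow> bool" where
  "protocol_shape S \<longleftrightarrow> has_nonsing S \<or> alice_split S \<or> alice_split (swo ` S)"

lemma in_swo_image: "K \<in> swo ` S \<longleftrightarrow> swo K \<in> S"
  by (auto intro: image_eqI[of _ _ "swo K"])

lemma has_nonsing_swap: "has_nonsing (swo ` S) \<longleftrightarrow> has_nonsing S"
  by (auto simp: has_nonsing_def in_swo_image)

lemma alice_step_swap:
  assumes "alice_step S S'"
  shows "bob_step (swo ` S) (swo ` S')"
  unfolding bob_step_def
proof
  fix K assume "K \<in> swo ` S"
  then obtain K' where K': "K' \<in> S" "K = swo K'" by blast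
  obtain F where "local_instr F" "\<forall>A\<in>set F. kron A (mat 1) ** K' \<in> S'"
    using assms K'(1) unfolding alice_step_def by blast
  moreover have "kron (mat 1) A ** K = swo (kron A (mat 1) ** K')" for A
    by (simp add: K')
  ultimately show "\<exists>F. local_instr F \<and> (\<forall>A\<in>set F. kron (mat 1) A ** K \<in> swo ` S')"
    by (auto simp: in_swo_image)
qed

lemma bob_step_swap:
  assumes "bob_step S S'"
  shows "alice_step (swo ` S) (swo ` S')"
  unfolding alice_step_def
proof
  fix K assume "K \<in> swo ` S"
  then obtain K' where K': "K' \<in> S" "K = swo K'" by blast
  obtain F where "local_instr F" "\<forall>A\<in>set F. kron (mat 1) A ** K' \<in> S'"
    using assms K'(1) unfolding bob_step_def by blast
  moreover have "kron A (mat 1) ** K = swo (kron (mat 1) A ** K')" for A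
    by (simp add: K')
  ultimately show "\<exists>F. local_instr F \<and> (\<forall>A\<in>set F. kron A (mat 1) ** K \<in> swo ` S')"
    by (auto simp: in_swo_image)
qed

lemma swo_swo_image [simp]: "swo ` swo ` S = S"
  by (simp add: image_image)

text \<open>Alice's round may create her own split and preserves an existing one. After exchange it
  is a round of Bob, which preserves the split in the third alternative.\<close>

lemma alice_step_shape:
  assumes "alice_step S S'" "protocol_shape S"
  shows "protocol_shape S'"
  using assms alice_step_has_nonsing alice_step_alice_dir bob_step_alice_dir[OF alice_step_swap[OF assms(1)]]
  unfolding protocol_shape_def alice_split_def by blast

lemma protocol_shape_swap: "protocol_shape (swo ` S) \<longleftrightarrow> protocol_shape S"
  by (auto simp: protocol_shape_def has_nonsing_swap)

lemma bob_step_shape: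
  assumes "bob_step S S'" "protocol_shape S"
  shows "protocol_shape S'"
  using alice_step_shape[OF bob_step_swap[OF assms(1)]] assms(2) by (simp add: protocol_shape_swap)

lemma locc_kraus_shape: "locc_kraus Ks \<Longrightarrow> protocol_shape (set Ks)"
proof (induction rule: locc_kraus.induct)
  case triv
  have "kron (mat 1) (mat 1) \<in> set [mat 1]" by (simp add: kron_mat_1)
  then show ?case using nonsing_mat_1 unfolding protocol_shape_def has_nonsing_def by blast
next
  case (alice Ks F)
  show ?case
  proof (rule alice_step_shape[OF _ alice(3)], unfold alice_step_def, intro ballI)
    fix K assume "K \<in> set Ks"
    then obtain m where "m < length Ks" "K = Ks ! m" by (metis in_set_conv_nth)
    then show "\<exists>G. local_instr G \<and> (\<forall>A\<in>set G. kron A (mat 1) ** K \<in> set (concat (map (\<lambda>m. map (\<lambda>A. kron A (mat 1) ** (Ks ! m)) (F m)) [0..<length Ks])))"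
      using alice(2) by (intro exI[of _ "F m"]) auto
  qed
next
  case (bob Ks F)
  show ?case
  proof (rule bob_step_shape[OF _ bob(3)], unfold bob_step_def, intro ballI)
    fix K assume "K \<in> set Ks"
    then obtain m where "m < length Ks" "K = Ks ! m" by (metis in_set_conv_nth)
    then show "\<exists>G. local_instr G \<and> (\<forall>A\<in>set G. kron (mat 1) A ** K \<in> set (concat (map (\<lambda>m. map (\<lambda>A. kron (mat 1) A ** (Ks ! m)) (F m)) [0..<length Ks])))"
      using bob(2) by (intro exI[of _ "F m"]) auto
  qed
qed

section \<open>States excluded by a protocol\<close>

text \<open>Alice's side ends in the fixed vector \<open>u\<close>, so whether \<open>\<phi>\<close>
  is excluded depends only on Bob's residual vector \<open>pc a \<phi>\<close>.\<close>

lemma kron_mult_vec_rank_one: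
  assumes "\<And>v. A *v v = cinner a v *s u"
  shows "kron A B *v \<phi> = tensor u (B *v pc a \<phi>)"
proof -
  have A: "A $ i $ j = cnj (a $ j) * u $ i" for i j
    using arg_cong[OF assms[of "axis j 1"], of "\<lambda>v. v $ i"] exhaust_2[of j]
    by (auto simp: mult_vec_2 cinner_def sum_2 axis_def)
  show ?thesis
    by (simp add: vec22_eq_iff matrix_vector_mult_def sum_22 sum_2 pc_def A algebra_simps)
qed

lemma tensor_eq_0: "tensor u v = 0 \<Longrightarrow> u \<noteq> 0 \<Longrightarrow> v = 0"
  by (auto simp: vec22_eq_iff vec2_eq_iff)

lemma kills_rank_one:
  assumes "kron A B *v \<phi> = 0" "rank_one A a"
  shows "B *v pc a \<phi> = 0"
  using assms kron_mult_vec_rank_one[of A a _ B \<phi>] tensor_eq_0 unfolding rank_one_def by metis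

lemma kills_rank_one_nonsing:
  assumes "kron A B *v \<phi> = 0" "rank_one A a" "nonsing B"
  shows "pc a \<phi> = 0"
  using kills_rank_one[OF assms(1,2)] assms(3) unfolding nonsing_def by blast

lemma kills_rank_one_rank_one:
  assumes "kron A B *v \<phi> = 0" "rank_one A a" "rank_one B b"
  shows "cinner b (pc a \<phi>) = 0"
  using kills_rank_one[OF assms(1,2)] assms(3) unfolding rank_one_def
  by (metis vector_mul_eq_0)

text \<open>Seen as a coefficient matrix, \<open>\<phi>\<close> is acted on by \<open>B\<close>
  along its rows and by \<open>A\<close> along its columns, and the two actions are inverted one
  after the other.\<close>

lemma kills_nonsing:
  assumes "kron A B *v \<phi> = 0" "nonsing A" "nonsing B"
  shows "\<phi> = 0"
proof -
  have "A *v (\<chi> p. (B *v (\<chi> q. \<phi> $ (p, q))) $ r) = (\<chi> p. (kron A B *v \<phi>) $ (p, r))" for r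
    by (simp add: vec2_eq_iff mult_vec_2 matrix_vector_mult_def[of "kron A B"] sum_22 algebra_simps)
  then have "A *v (\<chi> p. (B *v (\<chi> q. \<phi> $ (p, q))) $ r) = 0" for r
    by (simp add: assms(1) vec_eq_iff)
  then have "(\<chi> p. (B *v (\<chi> q. \<phi> $ (p, q))) $ r) = 0" for r
    using assms(2) unfolding nonsing_def by blast
  then have "B *v (\<chi> q. \<phi> $ (p, q)) = 0" for p
    by (simp add: vec_eq_iff)
  then have "(\<chi> q. \<phi> $ (p, q)) = 0" for p
    using assms(3) unfolding nonsing_def by blast
  then show ?thesis by (simp add: vec_eq_iff)
qed

lemma orthogonal_two_directions:
  assumes "wedge b b' \<noteq> 0" "cinner b x = 0" "cinner b' x = 0"
  shows "x = 0"
proof -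
  \<comment> \<open>Cramer's rule for the system whose rows are the conjugates of \<open>b\<close>
    and \<open>b'\<close>.\<close>
  have "cnj (wedge b b') * x $ 1 = cnj (b' $ 2) * cinner b x - cnj (b $ 2) * cinner b' x"
    "cnj (wedge b b') * x $ 2 = cnj (b $ 1) * cinner b' x - cnj (b' $ 1) * cinner b x"
    by (simp_all add: wedge_def cinner_def sum_2 algebra_simps)
  then show ?thesis using assms by (simp add: vec2_eq_iff)
qed

lemma pc_two_directions:
  assumes "wedge a a' \<noteq> 0" "pc a \<phi> = 0" "pc a' \<phi> = 0"
  shows "\<phi> = 0"
proof -
  have pc: "pc a \<phi> $ q = cinner a (\<chi> p. \<phi> $ (p, q))" for a q
    by (simp add: pc_def cinner_def sum_2)
  have "(\<chi> p. \<phi> $ (p, q)) = 0" for q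
    by (rule orthogonal_two_directions[OF assms(1)]) (simp_all add: pc[symmetric] assms(2,3))
  then show ?thesis by (simp add: vec_eq_iff)
qed

text \<open>A state without residual vector for \<open>a\<close> is a product. The two states
  differ, since one state killed in two independent directions would be zero.\<close>

lemma two_killed_split:
  assumes onb: "onb \<psi>" and "i \<in> idx" "j \<in> idx" "wedge a a' \<noteq> 0"
    and "pc a (\<psi> i) = 0" "pc a' (\<psi> j) = 0"
  shows "separable_pair_split \<psi>"
proof -
  have ne: "i \<noteq> j" using pc_two_directions assms onb_nonzero by blast
  have "a \<noteq> 0" "a' \<noteq> 0" using assms(4) by (auto simp: wedge_def)
  then obtain c c' where "\<psi> i = tensor (perp a) c" "\<psi> j = tensor (perp a') c'"
    using pc_eq_0_imp_product assms(5,6) by metis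
  then show ?thesis using two_products_split onb assms(2,3) ne by blast
qed

text \<open>Two independent outcomes of Bob each exclude two of the three states, hence a common one.\<close>

lemma alice_dir_triple:
  assumes "alice_dir S a" "i \<noteq> j" "i \<noteq> k" "j \<noteq> k"
    and S: "\<And>K p q. K \<in> S \<Longrightarrow> p \<in> {i, j, k} \<Longrightarrow> q \<in> {i, j, k} \<Longrightarrow> K *v \<psi> p \<noteq> 0 \<Longrightarrow> K *v \<psi> q \<noteq> 0 \<Longrightarrow> p = q"
  shows "\<exists>p\<in>{i, j, k}. pc a (\<psi> p) = 0"
proof -
  have two: "\<exists>p q. p \<in> {i, j, k} \<and> q \<in> {i, j, k} \<and> p \<noteq> q \<and> K *v \<psi> p = 0 \<and> K *v \<psi> q = 0" if "K \<in> S" for K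
    using S[OF that, of i j] S[OF that, of i k] S[OF that, of j k] assms(2-4) by blast
  from assms(1) consider A B where "kron A B \<in> S" "rank_one A a" "nonsing B"
    | A B A' B' b b' where "kron A B \<in> S" "kron A' B' \<in> S" "rank_one A a" "rank_one A' a"
        "rank_one B b" "rank_one B' b'" "wedge b b' \<noteq> 0"
    unfolding alice_dir_def by blast
  then show ?thesis
  proof cases
    case 1
    then show ?thesis using two[OF 1(1)] kills_rank_one_nonsing by blast
  next
    case 2
    obtain p where "p \<in> {i, j, k}" "kron A B *v \<psi> p = 0" "kron A' B' *v \<psi> p = 0"
      using two[OF 2(1)] two[OF 2(2)] by blast
    then show ?thesis
      using kills_rank_one_rank_one 2 orthogonal_two_directions by metis
  qed
qed

lemma alice_split_triple:
  assumes onb: "onb \<psi>" and S: "alice_split S" and T: "{i, j, k} \<subseteq> idx" "i \<noteq> j" "i \<noteq> k" "j \<noteq> k"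
    and kills: "\<And>K p q. K \<in> S \<Longrightarrow> p \<in> {i, j, k} \<Longrightarrow> q \<in> {i, j, k} \<Longrightarrow> K *v \<psi> p \<noteq> 0 \<Longrightarrow> K *v \<psi> q \<noteq> 0 \<Longrightarrow> p = q"
  shows "separable_pair_split \<psi>"
proof -
  obtain a a' where a: "wedge a a' \<noteq> 0" "alice_dir S a" "alice_dir S a'"
    using S unfolding alice_split_def by blast
  obtain p q where "p \<in> {i, j, k}" "q \<in> {i, j, k}" "pc a (\<psi> p) = 0" "pc a' (\<psi> q) = 0"
    using alice_dir_triple[OF a(2) T(2-4), of \<psi>] alice_dir_triple[OF a(3) T(2-4), of \<psi>] kills by blast
  then show ?thesis using two_killed_split[OF onb _ _ a(1)] T(1) by blast
qed

text \<open>An invertible leaf would keep all three states. Otherwise one party has two independent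
  directions, each of which excludes a state of the triple.\<close>

lemma distinguishable_triple_split:
  assumes onb: "onb \<psi>" and L: "locc_kraus L" and T: "{i, j, k} \<subseteq> idx" "i \<noteq> j" "i \<noteq> k" "j \<noteq> k"
    and kills: "\<And>K p q. K \<in> set L \<Longrightarrow> p \<in> {i, j, k} \<Longrightarrow> q \<in> {i, j, k} \<Longrightarrow> K *v \<psi> p \<noteq> 0 \<Longrightarrow> K *v \<psi> q \<noteq> 0 \<Longrightarrow> p = q"
  shows "separable_pair_split \<psi>"
proof -
  consider "has_nonsing (set L)" | "alice_split (set L)" | "alice_split (swo ` set L)"
    using locc_kraus_shape[OF L] unfolding protocol_shape_def by blast
  then show ?thesis
  proof cases
    case 1
    then obtain A B where "kron A B \<in> set L" "nonsing A" "nonsing B" unfolding has_nonsing_def by blast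
    then show ?thesis using kills[of "kron A B" i j] kills_nonsing onb_nonzero[OF onb] T by blast
  next
    case 2
    then show ?thesis using alice_split_triple[OF onb _ T] kills by blast
  next
    case 3
    have "separable_pair_split (\<lambda>i. swv (\<psi> i))"
    proof (rule alice_split_triple[OF onb_swap[OF onb] 3 T])
      fix K p q
      assume "K \<in> swo ` set L" "p \<in> {i, j, k}" "q \<in> {i, j, k}" "K *v swv (\<psi> p) \<noteq> 0" "K *v swv (\<psi> q) \<noteq> 0"
      then show "p = q" by (intro kills[of "swo K"]) (simp_all only: in_swo_image mult_swv swv_eq_0 not_False_eq_True)
    qed
    then show ?thesis by (rule separable_pair_split_swap)
  qed
qed

text \<open>Two independent outcomes of Bob each exclude a pair. Pairs that meet give a state whose
  residual vector is orthogonal to two independent directions, hence zero.\<close>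

lemma alice_dir_pairs:
  assumes onb: "onb \<psi>" and "alice_dir S a"
    and S: "\<And>K. K \<in> S \<Longrightarrow> \<exists>i\<in>idx. \<exists>j\<in>idx. i \<noteq> j \<and> K *v \<psi> i = 0 \<and> K *v \<psi> j = 0"
  shows "separable_pair_split \<psi> \<or> (\<exists>p\<in>idx. pc a (\<psi> p) = 0)"
proof -
  from assms(2) consider A B where "kron A B \<in> S" "rank_one A a" "nonsing B"
    | A B A' B' b b' where "kron A B \<in> S" "kron A' B' \<in> S" "rank_one A a" "rank_one A' a"
        "rank_one B b" "rank_one B' b'" "wedge b b' \<noteq> 0"
    unfolding alice_dir_def by blast
  then show ?thesis
  proof cases
    case 1
    then show ?thesis using S[OF 1(1)] kills_rank_one_nonsing by blast
  next
    case 2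
    obtain i j where ij: "i \<in> idx" "j \<in> idx" "i \<noteq> j" "kron A B *v \<psi> i = 0" "kron A B *v \<psi> j = 0"
      using S[OF 2(1)] by blast
    obtain k l where kl: "k \<in> idx" "l \<in> idx" "k \<noteq> l" "kron A' B' *v \<psi> k = 0" "kron A' B' *v \<psi> l = 0"
      using S[OF 2(2)] by blast
    have i: "cinner b (pc a (\<psi> i)) = 0" "cinner b (pc a (\<psi> j)) = 0"
      using ij 2 kills_rank_one_rank_one by blast+
    have k: "cinner b' (pc a (\<psi> k)) = 0" "cinner b' (pc a (\<psi> l)) = 0"
      using kl 2 kills_rank_one_rank_one by blast+
    show ?thesis
    proof (cases "{i, j} \<inter> {k, l} = {}")
      case True
      \<comment> \<open>There are only four states, so disjoint pairs are complementary, as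
        \<open>pairing_split\<close> demands.\<close>
      obtain k' l' where "k' \<noteq> l'" "idx - {i, j} = {k', l'}" using idx_complement[OF ij(1-3)] .
      moreover from this have "k \<in> {k', l'}" "l \<in> {k', l'}" using True kl(1,2) by auto
      ultimately have "idx - {i, j} = {k, l}" using kl(3) by auto
      moreover have "a \<noteq> 0" "b \<noteq> 0" "b' \<noteq> 0" using 2 unfolding rank_one_def by auto
      ultimately show ?thesis
        using pairing_split[OF onb ij(1-3) kl(3)] i k by (simp add: cinner_tensor_pc)
    next
      case False
      then obtain p where "p \<in> {i, j}" "p \<in> {k, l}" by blast
      then have "p \<in> idx" "cinner b (pc a (\<psi> p)) = 0" "cinner b' (pc a (\<psi> p)) = 0"
        using i k ij by auto
      then show ?thesis using orthogonal_two_directions[OF 2(7)] by blast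
    qed
  qed
qed

lemma alice_split_pairs:
  assumes onb: "onb \<psi>" and S: "alice_split S"
    and kills: "\<And>K. K \<in> S \<Longrightarrow> \<exists>i\<in>idx. \<exists>j\<in>idx. i \<noteq> j \<and> K *v \<psi> i = 0 \<and> K *v \<psi> j = 0"
  shows "separable_pair_split \<psi>"
proof -
  obtain a a' where a: "wedge a a' \<noteq> 0" "alice_dir S a" "alice_dir S a'"
    using S unfolding alice_split_def by blast
  show ?thesis
    using alice_dir_pairs[OF onb a(2)] alice_dir_pairs[OF onb a(3)] kills two_killed_split[OF onb _ _ a(1)]
    by blast
qed

lemma pairs_split:
  assumes onb: "onb \<psi>" and L: "locc_kraus Ks"
    and kills: "\<And>K. K \<in> set Ks \<Longrightarrow> \<exists>i\<in>idx. \<exists>j\<in>idx. i \<noteq> j \<and> K *v \<psi> i = 0 \<and> K *v \<psi> j = 0"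
  shows "separable_pair_split \<psi>"
proof -
  consider "has_nonsing (set Ks)" | "alice_split (set Ks)" | "alice_split (swo ` set Ks)"
    using locc_kraus_shape[OF L] unfolding protocol_shape_def by blast
  then show ?thesis
  proof cases
    case 1
    then obtain A B where "kron A B \<in> set Ks" "nonsing A" "nonsing B" unfolding has_nonsing_def by blast
    then show ?thesis using kills[of "kron A B"] kills_nonsing onb_nonzero[OF onb] by blast
  next
    case 2
    then show ?thesis using alice_split_pairs[OF onb] kills by blast
  next
    case 3
    have "separable_pair_split (\<lambda>i. swv (\<psi> i))"
      by (rule alice_split_pairs[OF onb_swap[OF onb] 3]) (use kills in \<open>auto simp: swo_mult_vec\<close>)
    then show ?thesis by (rule separable_pair_split_swap)
  qed
qed

section \<open>Adaptive protocols and the three alternatives\<close>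

lemma adaptive_imp_split:
  assumes onb: "onb \<psi>" and "locc_two_copy_adaptive \<psi>"
  shows "locc_one_copy \<psi> \<or> separable_pair_split \<psi>"
proof -
  obtain Ks L where Ks: "locc_kraus Ks" and L: "\<forall>m<length Ks. locc_kraus (L m)"
    and dist: "\<forall>m<length Ks. \<forall>K'\<in>set (L m). \<forall>i\<in>idx. \<forall>j\<in>idx.
        (Ks ! m) *v \<psi> i \<noteq> 0 \<longrightarrow> K' *v \<psi> i \<noteq> 0 \<longrightarrow>
        (Ks ! m) *v \<psi> j \<noteq> 0 \<longrightarrow> K' *v \<psi> j \<noteq> 0 \<longrightarrow> i = j"
    using assms(2) unfolding locc_two_copy_adaptive_def by (elim exE conjE) (rule that)
  show ?thesis
  proof (rule ccontr)
    assume no: "\<not> ?thesis"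
    have "\<exists>i\<in>idx. \<exists>j\<in>idx. i \<noteq> j \<and> K *v \<psi> i = 0 \<and> K *v \<psi> j = 0" if K: "K \<in> set Ks" for K
    proof (rule ccontr)
      assume n: "\<not> ?thesis"
      obtain m where m: "m < length Ks" "K = Ks ! m" using K by (metis in_set_conv_nth)
      have d: "p = q" if "K' \<in> set (L m)" "p \<in> idx" "q \<in> idx" "K *v \<psi> p \<noteq> 0" "K *v \<psi> q \<noteq> 0"
        "K' *v \<psi> p \<noteq> 0" "K' *v \<psi> q \<noteq> 0" for K' p q
        using dist m that by blast
      have "\<exists>i\<in>idx. K *v \<psi> i = 0"
      proof (rule ccontr)
        assume "\<not> ?thesis"
        then have nz: "K *v \<psi> p \<noteq> 0" if "p \<in> idx" for p using that by blast
        \<comment> \<open>A leaf that keeps all four states leaves the whole task to the protocol on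
          the second copy.\<close>
        have "locc_one_copy \<psi>" unfolding locc_one_copy_def
        proof (intro exI[of _ "L m"] conjI ballI impI)
          show "locc_kraus (L m)" using L m by blast
          fix K' p q assume "K' \<in> set (L m)" "p \<in> idx" "q \<in> idx" "K' *v \<psi> p \<noteq> 0" "K' *v \<psi> q \<noteq> 0"
          then show "p = q" by (intro d nz)
        qed
        then show False using no by blast
      qed
      then obtain i where i: "i \<in> idx" "K *v \<psi> i = 0" by blast
      \<comment> \<open>Any label other than \<open>i\<close>; it only serves to name the three
        survivors \<open>j\<close>, \<open>k\<close>, \<open>l\<close>.\<close>
      obtain j where j: "j \<in> idx" "i \<noteq> j"
        using that[of "if i = 1 then 2 else 1"] by (simp add: idx_eq split: if_splits)
      obtain k l where kl: "k \<in> idx" "l \<in> idx" "k \<noteq> l" "idx - {i, j} = {k, l}"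
        using idx_complement[OF i(1) j] .
      have nz: "K *v \<psi> p \<noteq> 0" if "p \<in> {j, k, l}" for p
        using n i that j kl by blast
      \<comment> \<open>Exactly one state is excluded here, so the second copy must tell the other
        three apart.\<close>
      have "separable_pair_split \<psi>"
      proof (rule distinguishable_triple_split[OF onb, of "L m" j k l])
        show "locc_kraus (L m)" using L m by blast
        show "{j, k, l} \<subseteq> idx" "k \<noteq> l" using j kl by blast+
        show "j \<noteq> k" "j \<noteq> l" using kl by blast+
        fix K' p q assume "K' \<in> set (L m)" "p \<in> {j, k, l}" "q \<in> {j, k, l}" "K' *v \<psi> p \<noteq> 0" "K' *v \<psi> q \<noteq> 0"
        then show "p = q" using d nz j(1) kl(1,2) by blast
      qed
      then show False using no by blast
    qed
    then have "separable_pair_split \<psi>" by (rule pairs_split[OF onb Ks])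
    then show False using no by blast
  qed
qed

text \<open>The first copy reveals the pair; two orthogonal states are left, and a single copy
  always suffices to distinguish these.\<close>

lemma split_imp_adaptive:
  assumes onb: "onb \<psi>" and "separable_pair_split \<psi>"
  shows "locc_two_copy_adaptive \<psi>"
proof -
  obtain i j where ij: "i \<in> idx" "j \<in> idx" "i \<noteq> j" "locc_group \<psi> {i, j}"
    using assms(2) unfolding separable_pair_split_def by blast
  obtain Ks where Ks: "locc_kraus Ks" and group: "\<forall>K\<in>set Ks. (\<forall>p\<in>idx. K *v \<psi> p \<noteq> 0 \<longrightarrow> p \<in> {i, j}) \<or>
      (\<forall>p\<in>idx. K *v \<psi> p \<noteq> 0 \<longrightarrow> p \<notin> {i, j})"
    using ij(4) unfolding locc_group_def by blast
  obtain k l where kl: "k \<in> idx" "l \<in> idx" "k \<noteq> l" "idx - {i, j} = {k, l}"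
    using idx_complement[OF ij(1-3)] .
  have "cinner (\<psi> i) (\<psi> j) = 0" "cinner (\<psi> k) (\<psi> l) = 0" using onbD[OF onb] ij kl by auto
  then obtain L L' where L: "locc_kraus L" "\<And>K. K \<in> set L \<Longrightarrow> K *v \<psi> i = 0 \<or> K *v \<psi> j = 0"
    "locc_kraus L'" "\<And>K. K \<in> set L' \<Longrightarrow> K *v \<psi> k = 0 \<or> K *v \<psi> l = 0"
    using two_states_distinguishable by metis
  \<comment> \<open>A leaf that excludes all four states falls under the first case; either protocol
    would do there.\<close>
  define M where "M = (\<lambda>m. if \<forall>p\<in>idx. Ks ! m *v \<psi> p \<noteq> 0 \<longrightarrow> p \<in> {i, j} then L else L')"
  show ?thesis
    unfolding locc_two_copy_adaptive_def
  proof (intro exI conjI allI impI ballI)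
    show "locc_kraus Ks" by (rule Ks)
    show "locc_kraus (M m)" for m by (simp add: M_def L)
    fix m K' p q
    assume m: "m < length Ks" "K' \<in> set (M m)" "p \<in> idx" "q \<in> idx"
      and nz: "Ks ! m *v \<psi> p \<noteq> 0" "K' *v \<psi> p \<noteq> 0" "Ks ! m *v \<psi> q \<noteq> 0" "K' *v \<psi> q \<noteq> 0"
    show "p = q"
    proof (cases "\<forall>p\<in>idx. Ks ! m *v \<psi> p \<noteq> 0 \<longrightarrow> p \<in> {i, j}")
      case True
      then have "K' \<in> set L" "p \<in> {i, j}" "q \<in> {i, j}" using m nz by (auto simp: M_def)
      then show ?thesis using L(2) nz by blast
    next
      case False
      then have "p \<notin> {i, j}" "q \<notin> {i, j}" using group m nz nth_mem by blast+
      then have "p \<in> {k, l}" "q \<in> {k, l}" using kl m by blast+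
      moreover have "K' \<in> set L'" using m(2) unfolding M_def if_not_P[OF False] .
      ultimately show ?thesis using L(4) nz by blast
    qed
  qed
qed

lemma one_copy_imp_adaptive:
  assumes "locc_one_copy \<psi>"
  shows "locc_two_copy_adaptive \<psi>"
proof -
  obtain Ks where "locc_kraus Ks"
    "\<forall>K\<in>set Ks. \<forall>i\<in>idx. \<forall>j\<in>idx. K *v \<psi> i \<noteq> 0 \<longrightarrow> K *v \<psi> j \<noteq> 0 \<longrightarrow> i = j"
    using assms unfolding locc_one_copy_def by (elim exE conjE) (rule that)
  then show ?thesis
    unfolding locc_two_copy_adaptive_def
    by (intro exI[of _ Ks] exI[of _ "\<lambda>m. [mat 1]"]) (simp add: locc_kraus.triv, metis nth_mem)
qed

text \<open>Of the three states other than \<open>\<psi> l\<close> at least two are products, and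
  orthogonal product states span one block of a separable splitting.\<close>

lemma few_entangled_split:
  assumes onb: "onb \<psi>" and l: "l \<in> idx" "card {k \<in> idx - {l}. entangled (\<psi> k)} \<le> 1"
  shows "separable_pair_split \<psi>"
proof -
  let ?E = "{k \<in> idx - {l}. entangled (\<psi> k)}"
  let ?P = "{k \<in> idx - {l}. \<not> entangled (\<psi> k)}"
  have "card (idx - {l}) = 3" using l(1) by (subst card_Diff_subset) (auto simp: idx_def)
  moreover have "card ?E + card ?P = card (idx - {l})"
    by (subst card_Un_disjoint[symmetric]) (auto simp: idx_def intro!: arg_cong[of _ _ card])
  ultimately have "2 \<le> card ?P" using l(2) by simp
  then obtain i j where "i \<in> ?P" "j \<in> ?P" "i \<noteq> j"
    by (auto simp: numeral_2_eq_2 card_le_Suc_iff)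
  then show ?thesis
    using two_products_split[OF onb] unfolding entangled_def by blast
qed

theorem theorem1:
  fixes \<psi> :: "nat \<Rightarrow> tvec"
  assumes orth: "\<forall>i\<in>idx. \<forall>j\<in>idx. cinner (\<psi> i) (\<psi> j) = (if i = j then 1 else 0)"
  shows "locc_two_copy_adaptive \<psi> \<longleftrightarrow>
     locc_one_copy \<psi>
   \<or> (\<exists>l\<in>idx. locc_group \<psi> {l} \<and> card {k\<in>idx - {l}. entangled (\<psi> k)} \<le> 1)
   \<or> (\<exists>i\<in>idx. \<exists>j\<in>idx. i \<noteq> j \<and> locc_group \<psi> {i, j}
        \<and> separable (proj (\<psi> i) + proj (\<psi> j))
        \<and> separable (mat 1 - (proj (\<psi> i) + proj (\<psi> j))))"
proof -
  have onb: "onb \<psi>" using orth by (simp add: onb_def)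
  show ?thesis
    \<comment> \<open>Since (ii) leads to (iii), the equivalence reduces to comparing adaptive
      protocols with (i) and (iii).\<close>
    unfolding separable_pair_split_def[symmetric]
    using adaptive_imp_split[OF onb] one_copy_imp_adaptive split_imp_adaptive[OF onb]
      few_entangled_split[OF onb] by blast
qed

end
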